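(* Let $\Omega\subseteq\mathbb R^n$ be open and bounded, let $r>0$, and let $\mu$ denote Lebesgue measure. Suppose there exist a set $\Omega_0\subseteq\overline{\Omega}$ with $\mu(\Omega_0)>0$ and constants $\vartheta\in(0,1)$, $\eta_1,\eta_2,m,c\in(0,+\infty)$ and $p\in[1,+\infty)$ such that the functions $f\colon\overline{\Omega}\times[-r,r]\to[0,+\infty)$ and $k\colon\overline{\Omega}\times\overline{\Omega}\to\mathbb R$ satisfy: (1) $f$ satisfies the Carathéodory conditions: for every $u\in[-r,r]$ the function $t\mapsto f(t,u)$ is Lebesgue measurable; for a.e. $t\in\overline{\Omega}$ the function $u\mapsto f(t,u)$ is continuous; and there is a Lebesgue measurable $g_r\colon\overline{\Omega}\to[0,+\infty)$ such that for a.e. $t\in\overline{\Omega}$, $f(t,u)\le g_r(t)$ for all $u\in[-r,r]$; (2) for a.e. $t\in\Omega_0$, $\inf\{f(t,u): \vartheta m\mu(\Omega_0)^{-1/p}\le|u|\le r\}\ge\eta_1$; (3) $k$ is Lebesgue measurable on $\overline{\Omega}\times\overline{\Omega}$, for every $\tau\in\overline{\Omega}$ the function $s\mapsto k(\tau,s)$ is Lebesgue measurable on $\overline{\Omega}$, and $\lim_{t\to\tau}\int_{\overline{\Omega}}|k(t,s)-k(\tau,s)|g_r(s)\,ds=0$ for every $\tau\in\overline{\Omega}$; (4) there is a Lebesgue measurable $\Phi\colon\overline{\Omega}\to[0,+\infty)$ with $\Phi(t)\ge\eta_2$ for a.e. $t\in\Omega_0$; for every $t\in\overline{\Omega}$,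 $|k(t,s)|\le\Phi(s)$ for a.e. $s\in\overline{\Omega}$; and $c\,\Phi(s)\le\int_{\Omega_0}k(t,s)\,dt$ for a.e. $s\in\overline{\Omega}$; (5) $\int_{\overline{\Omega}}\Phi(s)g_r(s)\,ds<+\infty$; (6) $0<m\le rc\,\mu(\Omega_0)^{-1/q}$, where $q\in(1,+\infty]$ satisfies $p^{-1}+q^{-1}=1$. Then there exists $\lambda>0$ such that the Hammerstein integral equation $\lambda x(t)=\int_{\overline{\Omega}}k(t,s)f(s,x(s))\,ds$, $t\in\overline{\Omega}$, admits a continuous solution $x\colon\overline{\Omega}\to[-r,r]$ with $\bigl(\int_{\Omega_0}|x(t)|^p\,dt\bigr)^{1/p}=m$. *)

theory Defs
  imports "HOL-Analysis.Analysis"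
begin

end

theory Submission
  imports Defs "HOL-Complex_Analysis.Great_Picard"
begin

text \<open>
  Put \<open>T x t = \<integral> k t s * f s (x s) ds\<close>. The lower bound on \<open>k\<close> gives, by Fubini,
  \<open>\<integral> T x \<ge> c * \<integral> \<Phi> s * f s (x s) ds \<ge> c * sup \<bar>T x\<bar>\<close> with the first integral over \<open>\<Omega>0\<close>, and \<open>c \<le> \<mu>(\<Omega>0)\<close>. Adding the
  constant \<open>max 0 (m\<^sup>p - \<integral> \<bar>x\<bar>\<^sup>p)\<close> to \<open>T x\<close> preserves this cone condition and makes the result bounded
  away from zero, since \<open>f\<close> is bounded below wherever \<open>x\<close> is not small. Rescaling it to have \<open>L\<^sup>p(\<Omega>0)\<close>
  norm \<open>m\<close>, Hoelder's inequality and the cone condition bound it by \<open>r\<close>. The resulting operator \<open>G\<close> on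
  continuous functions with values in \<open>[-r, r]\<close> is equicontinuous and respects pointwise limits, so it
  has a fixed point; this has norm \<open>m\<close>, so the added constant is zero and \<open>x\<close> is a multiple of \<open>T x\<close>.
\<close>

section \<open>A fixed point theorem for equicontinuous operators\<close>

text \<open>The dimension is a number here, not a type, because it will be the size of a finite cover
  that depends on the required accuracy.\<close>

lemma brouwer_cube_sequential:
  fixes F :: "(nat \<Rightarrow> real) \<Rightarrow> nat \<Rightarrow> real"
  assumes range: "\<And>w i. (\<And>l. w l \<in> {0..1}) \<Longrightarrow> i < n \<Longrightarrow> F w i \<in> {0..1}"
    and cont: "\<And>W w i. (\<And>j l. W j l \<in> {0..1}) \<Longrightarrow> (\<And>l. w l \<in> {0..1}) \<Longrightarrow>
      (\<And>l. (\<lambda>j. W j l) \<longlonglongrightarrow> w l) \<Longrightarrow> i < n \<Longrightarrow> (\<lambda>j. F (W j) i) \<longlonglongrightarrow> F w i"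
  obtains w where "\<And>l. w l \<in> {0..1}" "\<And>i. i < n \<Longrightarrow> F w i = w i"
proof -
  \<comment> \<open>\<open>pt p\<close> scales grid points with coordinates up to
    \<open>Suc p\<close> into the unit cube. The \<open>min\<close> places every argument in the
    cube, so \<open>range\<close> and \<open>cont\<close> apply without a bound on \<open>x\<close>;
    coordinates from \<open>n\<close> on are frozen at 0.\<close>
  define pt :: "nat \<Rightarrow> (nat \<Rightarrow> nat) \<Rightarrow> nat \<Rightarrow> real" where
    "pt p x l = (if l < n then real (min (x l) (Suc p)) / real (Suc p) else 0)" for p x l
  have pt01: "pt p x l \<in> {0..1}" for p x l
    by (simp add: pt_def min_def)
  \<comment> \<open>Two vertices \<open>r\<close>, \<open>s\<close> of the grid cell with lowest
    corner \<open>q\<close> at which the \<open>i\<close>-th component of \<open>F - id\<close> has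
    opposite weak signs.\<close>
  define good where "good p q i r s \<longleftrightarrow>
     (\<forall>j<n. q j \<le> r j \<and> r j \<le> q j + 1) \<and> (\<forall>j<n. q j \<le> s j \<and> s j \<le> q j + 1)
     \<and> pt p r i \<le> F (pt p r) i \<and> F (pt p s) i \<le> pt p s i" for p q i r s
  have "\<exists>q. \<forall>i<n. \<exists>r s. good p q i r s" for p
  proof -
    \<comment> \<open>The label records the sign of \<open>F - id\<close>. Kuhn's lemma prescribes
      it on the faces \<open>x i = 0\<close> and \<open>x i = Suc p\<close>; there the prescribed
      value is still a correct sign because \<open>F\<close> maps into the cube.\<close>
    define label :: "(nat \<Rightarrow> nat) \<Rightarrow> nat \<Rightarrow> nat" where
      "label x i = (if x i = Suc p then 1 else if x i = 0 \<or> pt p x i \<le> F (pt p x) i then 0 else 1)" for x i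
    obtain q where q: "\<forall>i<n. q i < Suc p"
      and q2: "\<forall>i<n. \<exists>r s. (\<forall>j<n. q j \<le> r j \<and> r j \<le> q j + 1) \<and> (\<forall>j<n. q j \<le> s j \<and> s j \<le> q j + 1)
           \<and> label r i \<noteq> label s i"
      by (rule kuhn_lemma[of "Suc p" n label]) (auto simp: label_def)
    have rg: "F (pt p x) i \<in> {0..1}" if "i < n" for x i
      by (rule range[OF pt01 that])
    have low: "pt p x i \<le> F (pt p x) i" if "label x i = 0" "i < n" for x i
    proof (cases "x i = 0")
      case True
      then show ?thesis using rg[of i x] \<open>i < n\<close> by (simp add: pt_def)
    qed (use that in \<open>simp add: label_def split: if_splits\<close>)
    have up: "F (pt p x) i \<le> pt p x i" if "label x i \<noteq> 0" "i < n" for x i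
    proof (cases "x i = Suc p")
      case True
      then show ?thesis using rg[of i x] \<open>i < n\<close> by (simp add: pt_def)
    qed (use that in \<open>simp add: label_def split: if_splits\<close>)
    have "\<exists>r s. good p q i r s" if i: "i < n" for i
    proof -
      obtain r s where rs: "\<forall>j<n. q j \<le> r j \<and> r j \<le> q j + 1" "\<forall>j<n. q j \<le> s j \<and> s j \<le> q j + 1"
        "label r i \<noteq> label s i" using q2 i by blast
      show ?thesis
      proof (cases "label r i = 0")
        case True
        then have "good p q i r s" using rs low[OF True i] up[of s i] i by (simp add: good_def)
        then show ?thesis by blast
      next
        case False
        then have "label s i = 0" using rs(3) by (simp add: label_def split: if_splits)
        then have "good p q i s r" using rs low[of s i] up[OF False i] i by (simp add: good_def)
        then show ?thesis by blast
      qed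
    qed
    then show ?thesis by blast
  qed
  then obtain q r s where qrs: "\<And>p i. i < n \<Longrightarrow> good p (q p) i (r p i) (s p i)"
    by metis
  obtain \<phi> :: "nat \<Rightarrow> nat" where \<phi>: "strict_mono \<phi>"
    and "\<And>l. l \<in> UNIV \<Longrightarrow> \<exists>a. (\<lambda>j. pt (\<phi> j) (q (\<phi> j)) l) \<longlonglongrightarrow> a"
    by (rule function_convergent_subsequence[of UNIV "\<lambda>p l. pt p (q p) l" 1]) (use pt01 in auto)
  then obtain w where w: "\<And>l. (\<lambda>j. pt (\<phi> j) (q (\<phi> j)) l) \<longlonglongrightarrow> w l"
    by (metis UNIV_I)
  have w01: "w l \<in> {0..1}" for l
    using closed_sequentially[of "{0..1}" "\<lambda>j. pt (\<phi> j) (q (\<phi> j)) l"] pt01 w by blast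
  \<comment> \<open>Any choice of vertices of the cells has the same limit \<open>w\<close>, since a
    cell has side at most \<open>1 / Suc p\<close>.\<close>
  have near: "(\<lambda>j. pt (\<phi> j) (u j) l) \<longlonglongrightarrow> w l"
    if "\<And>j l. l < n \<Longrightarrow> q (\<phi> j) l \<le> u j l \<and> u j l \<le> q (\<phi> j) l + 1" for u l
  proof -
    have "norm (pt (\<phi> j) (u j) l - pt (\<phi> j) (q (\<phi> j)) l) \<le> inverse (real (Suc (\<phi> j)))" for j
    proof (cases "l < n")
      case True
      have "\<bar>real (min (u j l) (Suc (\<phi> j))) - real (min (q (\<phi> j) l) (Suc (\<phi> j)))\<bar> \<le> 1"
        using that[OF True, of j] by linarith
      then show ?thesis using True
        by (simp add: pt_def diff_divide_distrib[symmetric] inverse_eq_divide divide_right_mono del: of_nat_Suc)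
    qed (simp add: pt_def)
    moreover have "(\<lambda>j. inverse (real (Suc (\<phi> j)))) \<longlonglongrightarrow> 0"
      using LIMSEQ_subseq_LIMSEQ[OF LIMSEQ_inverse_real_of_nat \<phi>] unfolding o_def .
    ultimately have "(\<lambda>j. pt (\<phi> j) (u j) l - pt (\<phi> j) (q (\<phi> j)) l) \<longlonglongrightarrow> 0"
      by (rule Lim_null_comparison[OF always_eventually[OF allI]])
    from tendsto_add[OF this w[of l]] show ?thesis by simp
  qed
  \<comment> \<open>Both weak inequalities survive the limit: one along the vertices
    \<open>r\<close>, the other along the vertices \<open>s\<close>.\<close>
  have "F w i = w i" if i: "i < n" for i
  proof (rule antisym)
    have r: "(\<lambda>j. pt (\<phi> j) (r (\<phi> j) i) l) \<longlonglongrightarrow> w l" for l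
      by (rule near) (use qrs[OF i] in \<open>unfold good_def, blast\<close>)
    have s: "(\<lambda>j. pt (\<phi> j) (s (\<phi> j) i) l) \<longlonglongrightarrow> w l" for l
      by (rule near) (use qrs[OF i] in \<open>unfold good_def, blast\<close>)
    have low: "pt p (r p i) i \<le> F (pt p (r p i)) i" and up: "F (pt p (s p i)) i \<le> pt p (s p i) i" for p
      using qrs[OF i, of p] by (simp_all add: good_def)
    have Fr: "(\<lambda>j. F (pt (\<phi> j) (r (\<phi> j) i)) i) \<longlonglongrightarrow> F w i"
      by (rule cont[OF pt01 w01 r i])
    have Fs: "(\<lambda>j. F (pt (\<phi> j) (s (\<phi> j) i)) i) \<longlonglongrightarrow> F w i"
      by (rule cont[OF pt01 w01 s i])
    show "w i \<le> F w i"
      by (rule LIMSEQ_le[OF r[of i] Fr]) (simp add: low)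
    show "F w i \<le> w i"
      by (rule LIMSEQ_le[OF Fs s[of i]]) (simp add: up)
  qed
  with w01 show ?thesis using that by blast
qed

text \<open>Sampling at the centres of a finite cover and interpolating by a partition of unity turns \<open>G\<close>
  into a self-map of a cube; its fixed points are approximate fixed points of \<open>G\<close>, and
  Arzela-Ascoli provides a limit.\<close>

lemma equicontinuous_operator_fixpoint:
  fixes S :: "'a::euclidean_space set" and G :: "('a \<Rightarrow> real) \<Rightarrow> 'a \<Rightarrow> real" and r :: real
  defines "D \<equiv> {x. continuous_on S x \<and> x ` S \<subseteq> {-r..r}}"
  assumes "compact S" "r > 0"
    and G_range: "\<And>x t. x \<in> D \<Longrightarrow> t \<in> S \<Longrightarrow> G x t \<in> {-r..r}"
    and equi: "\<And>\<tau> e. \<tau> \<in> S \<Longrightarrow> e > 0 \<Longrightarrow>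
      \<exists>d>0. \<forall>x\<in>D. \<forall>t\<in>S. dist t \<tau> < d \<longrightarrow> \<bar>G x t - G x \<tau>\<bar> < e"
    and G_lim: "\<And>X x t. (\<And>j::nat. X j \<in> D) \<Longrightarrow> x \<in> D \<Longrightarrow> (\<And>t. t \<in> S \<Longrightarrow> (\<lambda>j. X j t) \<longlonglongrightarrow> x t) \<Longrightarrow> t \<in> S \<Longrightarrow>
      (\<lambda>j. G (X j) t) \<longlonglongrightarrow> G x t"
  obtains x where "x \<in> D" "\<And>t. t \<in> S \<Longrightarrow> G x t = x t"
proof -
  have approx: "\<exists>x\<in>D. \<forall>t\<in>S. \<bar>x t - G x t\<bar> \<le> e" if e: "e > 0" for e
  proof -
    obtain d where d: "\<And>\<tau>. \<tau> \<in> S \<Longrightarrow> d \<tau> > 0"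
      "\<And>\<tau> x t. \<tau> \<in> S \<Longrightarrow> x \<in> D \<Longrightarrow> t \<in> S \<Longrightarrow> dist t \<tau> < d \<tau> \<Longrightarrow> \<bar>G x t - G x \<tau>\<bar> < e"
      using equi[OF _ e] by metis
    \<comment> \<open>On each ball of the cover every \<open>G x\<close> with
      \<open>x \<in> D\<close> varies by less than \<open>e\<close>; the radii do not depend on
      \<open>x\<close>.\<close>
    obtain C where C: "C \<subseteq> S" "finite C" "S \<subseteq> (\<Union>\<tau>\<in>C. ball \<tau> (d \<tau>))"
      by (rule compactE_image[OF \<open>compact S\<close>, of S "\<lambda>\<tau>. ball \<tau> (d \<tau>)"])
         (use d in force)+
    obtain n and \<tau> :: "nat \<Rightarrow> 'a" where \<tau>: "C = \<tau> ` {i. i < n}"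
      using finite_imp_nat_seg_image_inj_on[OF C(2)] by metis
    have \<tau>S: "\<tau> i \<in> S" if "i < n" for i using C \<tau> that by auto
    define \<phi> where "\<phi> i t = max 0 (d (\<tau> i) - dist t (\<tau> i))" for i t
    define \<psi> where "\<psi> i t = \<phi> i t / (\<Sum>i<n. \<phi> i t)" for i t
    have \<phi>0: "\<phi> i t \<ge> 0" for i t by (simp add: \<phi>_def)
    have pos: "(\<Sum>i<n. \<phi> i t) > 0" if t: "t \<in> S" for t
    proof -
      obtain i where i: "i < n" "dist (\<tau> i) t < d (\<tau> i)" using C(3) t \<tau> by auto
      show ?thesis
        by (rule sum_pos2[of _ i]) (use i \<phi>0 in \<open>auto simp: \<phi>_def dist_commute\<close>)
    qed
    have \<psi>0: "\<psi> i t \<ge> 0" if "t \<in> S" for i t using \<phi>0 pos[OF that] by (simp add: \<psi>_def)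
    have \<psi>1: "(\<Sum>i<n. \<psi> i t) = 1" if "t \<in> S" for t
      using pos[OF that] by (simp add: \<psi>_def sum_divide_distrib[symmetric])
    have \<psi>cont: "continuous_on S (\<psi> i)" for i
      unfolding \<psi>_def[abs_def] \<phi>_def[abs_def]
      by (intro continuous_intros) (use pos in \<open>auto simp: \<phi>_def[abs_def] less_imp_neq[symmetric]\<close>)
    \<comment> \<open>\<open>E\<close> decodes a point of the cube: \<open>w i\<close> in
      \<open>[0, 1]\<close> becomes the value \<open>2 * r * w i - r\<close> in
      \<open>[-r, r]\<close> attached to the centre \<open>\<tau> i\<close>. Being a convex
      combination of such values, \<open>E w\<close> stays in \<open>D\<close>.\<close>
    define E where "E w t = (\<Sum>i<n. (2 * r * w i - r) * \<psi> i t)" for w t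
    have ED: "E w \<in> D" if w: "\<And>l. w l \<in> {0..1}" for w
    proof -
      have "continuous_on S (E w)" unfolding E_def[abs_def] by (intro continuous_intros \<psi>cont)
      moreover have "\<bar>E w t\<bar> \<le> r" if t: "t \<in> S" for t
      proof -
        have a: "\<bar>2 * r * w i - r\<bar> \<le> r" for i
          using w[of i] \<open>r > 0\<close> mult_left_mono[of "w i" 1 r] by (auto simp: abs_le_iff)
        have "\<bar>E w t\<bar> \<le> (\<Sum>i<n. \<bar>(2 * r * w i - r) * \<psi> i t\<bar>)" unfolding E_def by (rule sum_abs)
        also have "\<dots> \<le> (\<Sum>i<n. r * \<psi> i t)"
          by (rule sum_mono) (use a \<psi>0[OF t] in \<open>auto simp: abs_mult intro: mult_right_mono\<close>)
        also have "\<dots> = r" using \<psi>1[OF t] by (simp add: sum_distrib_left[symmetric])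
        finally show ?thesis .
      qed
      ultimately show ?thesis by (fastforce simp: D_def abs_le_iff)
    qed
    obtain w where w: "\<And>l. w l \<in> {0..1}" and fw: "\<And>i. i < n \<Longrightarrow> (G (E w) (\<tau> i) + r) / (2 * r) = w i"
    proof (rule brouwer_cube_sequential[of n "\<lambda>w i. (G (E w) (\<tau> i) + r) / (2 * r)"], goal_cases)
      case (1 w i)
      then show ?case using G_range[OF ED \<tau>S, of w i] \<open>r > 0\<close> by (auto simp: divide_simps)
    next
      case (2 W w i)
      have "(\<lambda>j. G (E (W j)) (\<tau> i)) \<longlonglongrightarrow> G (E w) (\<tau> i)"
        by (rule G_lim) (use 2 \<tau>S ED in \<open>auto simp: E_def intro!: tendsto_intros\<close>)
      then show ?case using \<open>r > 0\<close> by (intro tendsto_intros) auto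
    next
      case (3 w)
      show ?case by (rule 3(1)[OF 3(2,3)])
    qed
    have EDw: "E w \<in> D" by (rule ED) (rule w)
    have fw': "2 * r * w i - r = G (E w) (\<tau> i)" if "i < n" for i
      using fw[OF that] \<open>r > 0\<close> by (simp add: field_simps)
    have "\<bar>E w t - G (E w) t\<bar> \<le> e" if t: "t \<in> S" for t
    proof -
      \<comment> \<open>By the fixed point equation \<open>E w\<close> averages the values of
        \<open>G (E w)\<close> at the centres. A centre contributes only where \<open>t\<close> lies
        in its ball, and there the error is at most \<open>e\<close>.\<close>
      have "E w t - G (E w) t = (\<Sum>i<n. G (E w) (\<tau> i) * \<psi> i t) - (\<Sum>i<n. \<psi> i t) * G (E w) t"
        using \<psi>1[OF t] fw' by (simp add: E_def)
      also have "\<dots> = (\<Sum>i<n. (G (E w) (\<tau> i) - G (E w) t) * \<psi> i t)"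
        by (simp only: sum_distrib_right sum_subtractf left_diff_distrib mult.commute[of "\<psi> _ t"])
      finally have "\<bar>E w t - G (E w) t\<bar> \<le> (\<Sum>i<n. \<bar>(G (E w) (\<tau> i) - G (E w) t) * \<psi> i t\<bar>)"
        by (metis sum_abs)
      also have "\<dots> \<le> (\<Sum>i<n. e * \<psi> i t)"
      proof (rule sum_mono)
        fix i assume "i \<in> {..<n}"
        then have i: "i < n" by simp
        show "\<bar>(G (E w) (\<tau> i) - G (E w) t) * \<psi> i t\<bar> \<le> e * \<psi> i t"
        proof (cases "dist t (\<tau> i) < d (\<tau> i)")
          case True
          then have "\<bar>G (E w) (\<tau> i) - G (E w) t\<bar> \<le> e"
            using d(2)[OF \<tau>S[OF i] EDw t] by (simp add: abs_minus_commute)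
          then show ?thesis using \<psi>0[OF t, of i] by (simp add: abs_mult mult_right_mono)
        qed (simp add: \<psi>_def \<phi>_def)
      qed
      also have "\<dots> = e" using \<psi>1[OF t] by (simp add: sum_distrib_left[symmetric])
      finally show ?thesis .
    qed
    with EDw show ?thesis by blast
  qed
  have "\<exists>x\<in>D. \<forall>t\<in>S. \<bar>x t - G x t\<bar> \<le> inverse (real (Suc j))" for j
    by (rule approx) simp
  then obtain X where X: "\<And>j. X j \<in> D" and XG: "\<And>j t. t \<in> S \<Longrightarrow> \<bar>X j t - G (X j) t\<bar> \<le> inverse (real (Suc j))"
    by metis
  \<comment> \<open>Compactness is applied to the images \<open>G (X j)\<close>, as nothing is known
    about equicontinuity of the \<open>X j\<close> themselves. These then have the same limit
    because \<open>X j - G (X j)\<close> tends to 0.\<close>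
  obtain y and \<kappa> :: "nat \<Rightarrow> nat" where y: "continuous_on S y" and \<kappa>: "strict_mono \<kappa>"
    and unif: "\<And>e. 0 < e \<Longrightarrow> \<exists>N. \<forall>n t. n \<ge> N \<and> t \<in> S \<longrightarrow> norm (G (X (\<kappa> n)) t - y t) < e"
  proof (rule Arzela_Ascoli[of S "\<lambda>j. G (X j)" r])
    show "norm (G (X n) t) \<le> r" if "t \<in> S" for n t
      using G_range[OF X that, of n] by (auto simp: abs_le_iff)
    show "\<exists>d>0. \<forall>n y. y \<in> S \<and> norm (t - y) < d \<longrightarrow> norm (G (X n) t - G (X n) y) < e" if "t \<in> S" "0 < e" for t e
      using equi[OF that] X by (metis abs_minus_commute dist_commute dist_norm real_norm_def)
  qed (use assms in auto)
  have Gy: "(\<lambda>j. G (X (\<kappa> j)) t) \<longlonglongrightarrow> y t" if "t \<in> S" for t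
    using unif that by (fastforce simp: LIMSEQ_iff)
  have Xy: "(\<lambda>j. X (\<kappa> j) t) \<longlonglongrightarrow> y t" if t: "t \<in> S" for t
  proof -
    have "(\<lambda>j. X j t - G (X j) t) \<longlonglongrightarrow> 0"
      by (rule Lim_null_comparison[OF _ LIMSEQ_inverse_real_of_nat]) (use XG[OF t] in auto)
    from tendsto_add[OF LIMSEQ_subseq_LIMSEQ[OF this \<kappa>] Gy[OF t]] show ?thesis by (simp add: o_def)
  qed
  have yD: "y \<in> D"
  proof -
    have "y t \<in> {-r..r}" if "t \<in> S" for t
      using closed_sequentially[OF _ _ Gy[OF that], of "{-r..r}"] G_range[OF X that] by auto
    then show ?thesis using y by (auto simp: D_def)
  qed
  have "G y t = y t" if t: "t \<in> S" for t
    by (rule LIMSEQ_unique[OF G_lim[OF X yD Xy t] Gy[OF t]])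
  with yD show ?thesis using that by blast
qed

section \<open>Superposition and Fubini for Lebesgue measure\<close>

text \<open>Preimages of a Borel set under \<open>f\<close> and \<open>g\<close> differ only inside
  a null set, and completeness makes such a difference measurable.\<close>

lemma (in complete_measure) borel_measurable_cong_AE:
  assumes f: "f \<in> borel_measurable M" and eq: "AE x in M. f x = g x"
  shows "g \<in> borel_measurable M"
proof (rule measurableI)
  fix A :: "'b set" assume A: "A \<in> sets borel"
  show "g -` A \<inter> space M \<in> sets M"
  proof (rule in_sets_AE)
    show "f -` A \<inter> space M \<in> sets M" using f A by (rule measurable_sets)
    show "AE x in M. x \<in> f -` A \<inter> space M \<longleftrightarrow> x \<in> g -` A \<inter> space M"
      using eq by eventually_elim auto
  qed auto
qed auto

text \<open>For \<open>x\<close> with countably many values the composition is measurable piece by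
  piece; the general case is a pointwise limit of such compositions, by continuity in the second
  argument.\<close>

lemma borel_measurable_caratheodory_superposition:
  fixes f :: "'a \<Rightarrow> real \<Rightarrow> real" and a b :: real
  assumes meas: "\<And>u. u \<in> {a..b} \<Longrightarrow> (\<lambda>s. f s u) \<in> borel_measurable M"
    and cont: "\<And>s. s \<in> space M \<Longrightarrow> continuous_on {a..b} (f s)"
    and x[measurable]: "x \<in> borel_measurable M" and range: "\<And>s. s \<in> space M \<Longrightarrow> x s \<in> {a..b}"
  shows "(\<lambda>s. f s (x s)) \<in> borel_measurable M"
proof (cases "space M = {}")
  case False
  then have ab: "a \<le> b" using range by force
  \<comment> \<open>Rounding down may leave \<open>{a..b}\<close>, where nothing is assumed about
    \<open>f\<close>; clamping by \<open>cl\<close> repairs this without changing the limit.\<close>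
  define cl where "cl u = max a (min b u)" for u
  have cl: "cl u \<in> {a..b}" for u using ab by (auto simp: cl_def)
  define y where "y j s = of_int \<lfloor>real (Suc j) * x s\<rfloor> / real (Suc j)" for j s
  have y: "(\<lambda>j. y j s) \<longlonglongrightarrow> x s" for s
  proof -
    have "norm (y j s - x s) \<le> inverse (real (Suc j))" for j
    proof -
      have "y j s - x s = (of_int \<lfloor>real (Suc j) * x s\<rfloor> - real (Suc j) * x s) * inverse (real (Suc j))"
        by (simp add: y_def field_simps)
      moreover have "\<bar>of_int \<lfloor>real (Suc j) * x s\<rfloor> - real (Suc j) * x s\<bar> \<le> 1" by linarith
      ultimately show ?thesis by (simp add: abs_mult mult_left_le_one_le del: of_nat_Suc)
    qed
    then have "(\<lambda>j. y j s - x s) \<longlonglongrightarrow> 0"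
      by (intro Lim_null_comparison[OF always_eventually[OF allI] LIMSEQ_inverse_real_of_nat])
    then show ?thesis by (simp add: LIM_zero_iff)
  qed
  show ?thesis
  proof (rule borel_measurable_LIMSEQ_metric)
    show "(\<lambda>s. f s (cl (y j s))) \<in> borel_measurable M" for j
      unfolding y_def
      by (rule measurable_compose_countable'[where I = "UNIV :: int set" and
            f = "\<lambda>i s. f s (cl (of_int i / real (Suc j)))"]) (use meas cl in auto)
    show "(\<lambda>j. f s (cl (y j s))) \<longlonglongrightarrow> f s (x s)" if s: "s \<in> space M" for s
    proof (rule continuous_on_tendsto_compose[OF cont[OF s] _ range[OF s]])
      have "(\<lambda>j. cl (y j s)) \<longlonglongrightarrow> cl (x s)" unfolding cl_def by (intro tendsto_intros y)
      then show "(\<lambda>j. cl (y j s)) \<longlonglongrightarrow> x s" using range[OF s] by (simp add: cl_def)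
    qed (use cl in simp)
  qed
qed (auto simp: measurable_def)

section \<open>Null sets and Fubini's theorem for completed product measure\<close>

lemma AE_lebesgue_pair:
  fixes P :: "'a::euclidean_space \<times> 'b::euclidean_space \<Rightarrow> bool"
  assumes "AE z in lborel. P z"
  shows "AE x in lebesgue. AE y in lebesgue. P (x, y)" "AE y in lebesgue. AE x in lebesgue. P (x, y)"
proof -
  have P: "AE z in lborel \<Otimes>\<^sub>M lborel. P z" by (subst lborel_prod) (rule assms)
  show "AE x in lebesgue. AE y in lebesgue. P (x, y)"
    using lborel_pair.AE_pair[OF P] by (simp add: AE_completion_iff)
  \<comment> \<open>Swapping the factors preserves the product measure, which gives the statement
    for slices in the other direction.\<close>
  have swap: "distr (lborel \<Otimes>\<^sub>M lborel) (lborel \<Otimes>\<^sub>M lborel) (\<lambda>(x, y). (y, x)) = (lborel \<Otimes>\<^sub>M lborel :: ('a \<times> 'b) measure)"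
    by (rule lborel_pair.distr_pair_swap[symmetric])
  have "AE z in lborel \<Otimes>\<^sub>M lborel. P ((\<lambda>(y, x). (x, y)) z)"
    by (rule AE_distrD[OF measurable_pair_swap']) (unfold swap, rule P)
  then show "AE y in lebesgue. AE x in lebesgue. P (x, y)"
    by (auto dest: lborel_pair.AE_pair simp: AE_completion_iff)
qed

text \<open>Lebesgue measure on the product is the completion of the product of the Borel measures.
  So \<open>h\<close> is replaced by a Borel function equal to it almost everywhere: almost all
  slices of the two agree almost everywhere, and Fubini for the Borel function carries over.\<close>

lemma lebesgue_Fubini:
  fixes h :: "'a::euclidean_space \<Rightarrow> 'b::euclidean_space \<Rightarrow> real"
  assumes meas: "(\<lambda>(t, s). h t s) \<in> borel_measurable lebesgue"
    and fin: "(\<integral>\<^sup>+ t. \<integral>\<^sup>+ s. ennreal \<bar>h t s\<bar> \<partial>lebesgue \<partial>lebesgue) < \<infinity>"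
  shows "integrable lebesgue (\<lambda>t. \<integral>s. h t s \<partial>lebesgue)" (is ?A)
    and "integrable lebesgue (\<lambda>s. \<integral>t. h t s \<partial>lebesgue)" (is ?B)
    and "(\<integral>t. \<integral>s. h t s \<partial>lebesgue \<partial>lebesgue) = (\<integral>s. \<integral>t. h t s \<partial>lebesgue \<partial>lebesgue)" (is ?C)
proof -
  obtain h0 where h0: "h0 \<in> borel_measurable lborel" and eq: "AE z in lborel. (\<lambda>(t, s). h t s) z = h0 z"
    using completion_ex_borel_measurable_real[OF meas] by blast
  define h' where "h' t s = h0 (t, s)" for t s
  have h'[measurable]: "case_prod h' \<in> borel_measurable (lborel \<Otimes>\<^sub>M lborel)"
    using h0 by (simp add: h'_def[abs_def] lborel_prod)
  note ae = AE_lebesgue_pair[OF eq, simplified, folded h'_def]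
  \<comment> \<open>The slice \<open>h t\<close> is known to be measurable only for almost every
    \<open>t\<close>, as a function almost equal to a Borel slice.\<close>
  have ae1: "AE t in lebesgue. (\<integral>s. h t s \<partial>lebesgue) = (\<integral>s. h' t s \<partial>lborel)"
    using ae(1)
  proof eventually_elim
    fix t assume t: "AE s in lebesgue. h t s = h' t s"
    have m: "h' t \<in> borel_measurable lborel" by measurable
    then have "h' t \<in> borel_measurable lebesgue" by (rule measurable_completion)
    moreover from this have "h t \<in> borel_measurable lebesgue"
      by (rule completion.borel_measurable_cong_AE) (use t in auto)
    ultimately show "(\<integral>s. h t s \<partial>lebesgue) = (\<integral>s. h' t s \<partial>lborel)"
      using t m by (subst integral_completion[symmetric]) (auto intro!: integral_cong_AE)
  qed
  have ae2: "AE s in lebesgue. (\<integral>t. h t s \<partial>lebesgue) = (\<integral>t. h' t s \<partial>lborel)"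
    using ae(2)
  proof eventually_elim
    fix s assume s: "AE t in lebesgue. h t s = h' t s"
    have m: "(\<lambda>t. h' t s) \<in> borel_measurable lborel" by measurable
    then have "(\<lambda>t. h' t s) \<in> borel_measurable lebesgue" by (rule measurable_completion)
    moreover from this have "(\<lambda>t. h t s) \<in> borel_measurable lebesgue"
      by (rule completion.borel_measurable_cong_AE) (use s in auto)
    ultimately show "(\<integral>t. h t s \<partial>lebesgue) = (\<integral>t. h' t s \<partial>lborel)"
      using s m by (subst integral_completion[symmetric]) (auto intro!: integral_cong_AE)
  qed
  have int: "integrable (lborel \<Otimes>\<^sub>M lborel) (case_prod h')"
  proof (rule integrableI_bounded)
    have "(\<integral>\<^sup>+ z. ennreal (norm (case_prod h' z)) \<partial>(lborel \<Otimes>\<^sub>M lborel)) = (\<integral>\<^sup>+ t. \<integral>\<^sup>+ s. ennreal \<bar>h' t s\<bar> \<partial>lebesgue \<partial>lebesgue)"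
      by (subst lborel.nn_integral_fst[symmetric]) (simp_all add: nn_integral_completion)
    also have "\<dots> = (\<integral>\<^sup>+ t. \<integral>\<^sup>+ s. ennreal \<bar>h t s\<bar> \<partial>lebesgue \<partial>lebesgue)"
      using ae(1) by (intro nn_integral_cong_AE) (auto elim!: eventually_mono intro!: nn_integral_cong_AE)
    finally show "(\<integral>\<^sup>+ z. ennreal (norm (case_prod h' z)) \<partial>(lborel \<Otimes>\<^sub>M lborel)) < \<infinity>" using fin by simp
  qed (rule h')
  have i1: "integrable lebesgue (\<lambda>t. \<integral>s. h' t s \<partial>lborel)"
    using lborel_pair.integrable_fst[OF int] by (subst integrable_completion) auto
  have i2: "integrable lebesgue (\<lambda>s. \<integral>t. h' t s \<partial>lborel)"
    using lborel_pair.integrable_snd[OF int] by (subst integrable_completion) auto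
  have m1: "(\<lambda>t. \<integral>s. h t s \<partial>lebesgue) \<in> borel_measurable lebesgue"
    by (rule completion.borel_measurable_cong_AE[OF borel_measurable_integrable[OF i1]]) (use ae1 in \<open>auto elim: eventually_mono\<close>)
  have m2: "(\<lambda>s. \<integral>t. h t s \<partial>lebesgue) \<in> borel_measurable lebesgue"
    by (rule completion.borel_measurable_cong_AE[OF borel_measurable_integrable[OF i2]]) (use ae2 in \<open>auto elim: eventually_mono\<close>)
  show ?A using i1 m1 ae1 integrable_cong_AE[OF m1 _ ae1] by auto
  show ?B using i2 m2 ae2 integrable_cong_AE[OF m2 _ ae2] by auto
  have "(\<integral>t. \<integral>s. h t s \<partial>lebesgue \<partial>lebesgue) = (\<integral>t. \<integral>s. h' t s \<partial>lborel \<partial>lborel)"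
    using integral_cong_AE[OF m1 borel_measurable_integrable[OF i1] ae1]
    by (simp add: integral_completion[OF borel_measurable_integrable[OF lborel_pair.integrable_fst[OF int]]])
  also have "\<dots> = (\<integral>s. \<integral>t. h' t s \<partial>lborel \<partial>lborel)"
    by (rule lborel_pair.Fubini_integral[OF int, symmetric])
  also have "\<dots> = (\<integral>s. \<integral>t. h t s \<partial>lebesgue \<partial>lebesgue)"
    using integral_cong_AE[OF m2 borel_measurable_integrable[OF i2] ae2]
    by (simp add: integral_completion[OF borel_measurable_integrable[OF lborel_pair.integrable_snd[OF int]]])
  finally show ?C .
qed

section \<open>Superposition under conditions that hold almost everywhere\<close>

lemma complete_measure_lebesgue_on:
  assumes "S \<in> sets lebesgue"
  shows "complete_measure (lebesgue_on S)"
proof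
  fix A B assume "B \<subseteq> A" "A \<in> null_sets (lebesgue_on S)"
  then show "B \<in> sets (lebesgue_on S)"
    using assms completion.complete2[of B A lborel] null_sets_restrict_space[OF assms]
    by (metis null_setsD2 subset_trans)
qed

text \<open>Setting \<open>f\<close> to 0 on a null set containing all bad points gives continuity
  everywhere; completeness then transfers measurability back to \<open>f\<close>.\<close>

lemma borel_measurable_caratheodory_superposition_AE:
  fixes f :: "'a \<Rightarrow> real \<Rightarrow> real" and a b :: real
  assumes "complete_measure M"
    and meas: "\<And>u. u \<in> {a..b} \<Longrightarrow> (\<lambda>s. f s u) \<in> borel_measurable M"
    and cont: "AE s in M. continuous_on {a..b} (f s)"
    and x: "x \<in> borel_measurable M" and range: "\<And>s. s \<in> space M \<Longrightarrow> x s \<in> {a..b}"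
  shows "(\<lambda>s. f s (x s)) \<in> borel_measurable M"
proof -
  interpret complete_measure M by fact
  obtain N where N: "N \<in> null_sets M" "{s \<in> space M. \<not> continuous_on {a..b} (f s)} \<subseteq> N"
    using cont by (auto elim!: AE_E simp: null_sets_def)
  define f' where "f' s u = (if s \<in> N then 0 else f s u)" for s u
  have [measurable]: "N \<in> sets M" using N by auto
  have "(\<lambda>s. f' s (x s)) \<in> borel_measurable M"
  proof (rule borel_measurable_caratheodory_superposition[OF _ _ x range])
    show "(\<lambda>s. f' s u) \<in> borel_measurable M" if "u \<in> {a..b}" for u
    proof -
      note [measurable] = meas[OF that]
      show ?thesis unfolding f'_def by measurable
    qed
    show "continuous_on {a..b} (f' s)" if "s \<in> space M" for s
      using N that by (cases "s \<in> N") (auto simp: f'_def[abs_def])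
  qed
  then show ?thesis
    by (rule borel_measurable_cong_AE) (use AE_not_in[OF N(1)] in \<open>auto simp: f'_def elim!: eventually_mono\<close>)
qed

section \<open>Integrating the lower bound for the kernel\<close>

lemma measurable_snd_lebesgue:
  "snd \<in> (lebesgue :: ('a::euclidean_space \<times> 'b::euclidean_space) measure) \<rightarrow>\<^sub>M lebesgue"
proof (rule completion.measurable_completion2)
  have snd: "snd \<in> (lborel :: ('a \<times> 'b) measure) \<rightarrow>\<^sub>M lborel"
    by (subst lborel_prod[symmetric]) measurable
  then show m: "snd \<in> (lebesgue :: ('a \<times> 'b) measure) \<rightarrow>\<^sub>M lborel"
    by (rule measurable_completion)
  \<comment> \<open>For the completed target, preimages of null sets must be null as well: the strip
    \<open>UNIV \<times> N\<close> has measure \<open>\<infinity> * 0 = 0\<close>.\<close>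
  show "null_sets lborel \<subseteq> null_sets (distr (lebesgue :: ('a \<times> 'b) measure) lborel snd)"
  proof
    fix N :: "'b set" assume N: "N \<in> null_sets lborel"
    have "emeasure (lborel :: ('a \<times> 'b) measure) (UNIV \<times> N) = 0"
      using N by (subst lborel_prod[symmetric], subst lborel.emeasure_pair_measure_Times) auto
    moreover have "snd -` N = (UNIV :: 'a set) \<times> N" by auto
    moreover have "snd -` N \<in> sets (lborel :: ('a \<times> 'b) measure)"
      using measurable_sets[OF snd, of N] N by auto
    ultimately show "N \<in> null_sets (distr (lebesgue :: ('a \<times> 'b) measure) lborel snd)"
      using N m by (auto simp: null_sets_def emeasure_distr)
  qed
qed

lemma measurable_fst_lebesgue:
  "fst \<in> (lebesgue :: ('a::euclidean_space \<times> 'b::euclidean_space) measure) \<rightarrow>\<^sub>M lebesgue"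
proof (rule completion.measurable_completion2)
  have fst: "fst \<in> (lborel :: ('a \<times> 'b) measure) \<rightarrow>\<^sub>M lborel"
    by (subst lborel_prod[symmetric]) measurable
  then show m: "fst \<in> (lebesgue :: ('a \<times> 'b) measure) \<rightarrow>\<^sub>M lborel"
    by (rule measurable_completion)
  show "null_sets lborel \<subseteq> null_sets (distr (lebesgue :: ('a \<times> 'b) measure) lborel fst)"
  proof
    fix N :: "'a set" assume N: "N \<in> null_sets lborel"
    have "emeasure (lborel :: ('a \<times> 'b) measure) (N \<times> UNIV) = 0"
      using N by (subst lborel_prod[symmetric], subst lborel.emeasure_pair_measure_Times) auto
    moreover have "fst -` N = N \<times> (UNIV :: 'b set)" by auto
    moreover have "fst -` N \<in> sets (lborel :: ('a \<times> 'b) measure)"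
      using measurable_sets[OF fst, of N] N by auto
    ultimately show "N \<in> null_sets (distr (lebesgue :: ('a \<times> 'b) measure) lborel fst)"
      using N m by (auto simp: null_sets_def emeasure_distr)
  qed
qed

text \<open>After exchanging the integrals, \<open>k_lower\<close> applies pointwise under the
  integral over \<open>s\<close>. The weight \<open>F\<close> is left general because two choices
  are needed: \<open>f s (x s)\<close>, and a weight that compares \<open>c\<close> with the measure
  of \<open>\<Omega>0\<close>.\<close>

lemma kernel_Fubini_lower_bound:
  fixes S \<Omega>0 :: "'a::euclidean_space set" and k :: "'a \<Rightarrow> 'a \<Rightarrow> real" and \<Phi> F :: "'a \<Rightarrow> real" and c :: real
  assumes S: "S \<in> sets lebesgue" and O: "\<Omega>0 \<in> lmeasurable" "\<Omega>0 \<subseteq> S"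
    and k_meas: "set_borel_measurable lebesgue (S \<times> S) (\<lambda>(t, s). k t s)"
    and k_bound: "\<And>t. t \<in> S \<Longrightarrow> AE s in lebesgue_on S. \<bar>k t s\<bar> \<le> \<Phi> s"
    and k_lower: "AE s in lebesgue_on S. c * \<Phi> s \<le> (\<integral>t. k t s \<partial>lebesgue_on \<Omega>0)"
    and F: "F \<in> borel_measurable (lebesgue_on S)" "\<And>s. s \<in> S \<Longrightarrow> 0 \<le> F s"
    and int: "integrable (lebesgue_on S) (\<lambda>s. \<Phi> s * F s)"
  shows "c * (\<integral>s. \<Phi> s * F s \<partial>lebesgue_on S) \<le> (\<integral>t. \<integral>s. k t s * F s \<partial>lebesgue_on S \<partial>lebesgue_on \<Omega>0)"
proof -
  have O': "\<Omega>0 \<in> sets lebesgue" using O by auto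
  \<comment> \<open>Cut off to the whole space, since \<open>k\<close> and \<open>F\<close> are
    uncontrolled outside \<open>S \<times> S\<close> and \<open>S\<close>.\<close>
  define h where "h t s = (if t \<in> \<Omega>0 then if s \<in> S then k t s * F s else 0 else 0)" for t s
  have meas: "(\<lambda>(t, s). h t s) \<in> borel_measurable lebesgue"
  proof -
    define F' where "F' s = (if s \<in> S then F s else 0)" for s
    have F': "F' \<in> borel_measurable lebesgue"
      unfolding F'_def by (rule borel_measurable_if_I) (use F S in auto)
    have I: "indicat_real \<Omega>0 \<in> borel_measurable lebesgue" using O' by simp
    have "(\<lambda>z. indicat_real \<Omega>0 (fst z) * (indicat_real (S \<times> S) z * k (fst z) (snd z)) * F' (snd z)) \<in> borel_measurable lebesgue"
      using measurable_compose[OF measurable_fst_lebesgue I] measurable_compose[OF measurable_snd_lebesgue F'] k_meas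
      by (intro borel_measurable_times[OF borel_measurable_times]) (auto simp: set_borel_measurable_def split_beta')
    also have "(\<lambda>z. indicat_real \<Omega>0 (fst z) * (indicat_real (S \<times> S) z * k (fst z) (snd z)) * F' (snd z)) = (\<lambda>(t, s). h t s)"
      using O by (intro ext) (auto simp: h_def F'_def indicator_def split: if_splits)
    finally show ?thesis .
  qed
  define I where "I = (\<integral>s. \<Phi> s * F s \<partial>lebesgue_on S)"
  \<comment> \<open>The bound by \<open>\<Phi> s * F s\<close> is the same for all \<open>t\<close>,
    so finiteness of the iterated integral follows from the finite measure of
    \<open>\<Omega>0\<close>.\<close>
  have inner: "(\<integral>\<^sup>+ s. ennreal \<bar>h t s\<bar> \<partial>lebesgue) \<le> ennreal I * indicator \<Omega>0 t" for t
  proof (cases "t \<in> \<Omega>0")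
    case True
    then have t: "t \<in> S" using O by auto
    have ae: "AE s in lebesgue_on S. \<bar>k t s * F s\<bar> \<le> \<Phi> s * F s"
      using k_bound[OF t] AE_space
      by eventually_elim (auto simp: abs_mult F intro!: mult_right_mono)
    have "(\<integral>\<^sup>+ s. ennreal \<bar>h t s\<bar> \<partial>lebesgue) = (\<integral>\<^sup>+ s. ennreal \<bar>k t s * F s\<bar> \<partial>lebesgue_on S)"
      using S by (subst nn_integral_restrict_space) (auto intro!: nn_integral_cong simp: h_def True indicator_def)
    also have "\<dots> \<le> (\<integral>\<^sup>+ s. ennreal (\<Phi> s * F s) \<partial>lebesgue_on S)"
      using ae by (intro nn_integral_mono_AE) (auto elim!: eventually_mono intro!: ennreal_leI)
    also have "\<dots> = ennreal I"
      unfolding I_def by (rule nn_integral_eq_integral[OF int]) (use ae in \<open>auto elim!: eventually_mono\<close>)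
    finally show ?thesis using True by simp
  qed (simp add: h_def)
  have fin: "(\<integral>\<^sup>+ t. \<integral>\<^sup>+ s. ennreal \<bar>h t s\<bar> \<partial>lebesgue \<partial>lebesgue) < \<infinity>"
  proof -
    have "(\<integral>\<^sup>+ t. \<integral>\<^sup>+ s. ennreal \<bar>h t s\<bar> \<partial>lebesgue \<partial>lebesgue) \<le> (\<integral>\<^sup>+ t. ennreal I * indicator \<Omega>0 t \<partial>lebesgue)"
      by (intro nn_integral_mono inner)
    also have "\<dots> = ennreal I * emeasure lebesgue \<Omega>0" using O' by (rule nn_integral_cmult_indicator)
    also have "\<dots> < \<infinity>" using O(1) by (auto simp: ennreal_mult_less_top fmeasurable_def)
    finally show ?thesis .
  qed
  note fub = lebesgue_Fubini[OF meas fin]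
  have ht: "(\<integral>s. h t s \<partial>lebesgue) = (if t \<in> \<Omega>0 then \<integral>s. k t s * F s \<partial>lebesgue_on S else 0)" for t
    using Lebesgue_Measure.integral_restrict_UNIV[OF S, of "\<lambda>s. k t s * F s"] by (simp add: h_def)
  have hs: "(\<integral>t. h t s \<partial>lebesgue) = (if s \<in> S then F s * (\<integral>t. k t s \<partial>lebesgue_on \<Omega>0) else 0)" for s
    using Lebesgue_Measure.integral_restrict_UNIV[OF O', of "\<lambda>t. k t s * F s"] by (simp add: h_def if_distrib cong: if_cong)
  have "c * I = (\<integral>s. c * (\<Phi> s * F s) \<partial>lebesgue_on S)" by (simp add: I_def)
  also have "\<dots> = (\<integral>s. (if s \<in> S then c * (\<Phi> s * F s) else 0) \<partial>lebesgue)"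
    by (rule Lebesgue_Measure.integral_restrict_UNIV[OF S, symmetric])
  also have "\<dots> \<le> (\<integral>s. \<integral>t. h t s \<partial>lebesgue \<partial>lebesgue)"
  proof (rule integral_mono_AE)
    show "integrable lebesgue (\<lambda>s. if s \<in> S then c * (\<Phi> s * F s) else 0)"
      using int by (simp add: Lebesgue_Measure.integrable_restrict_UNIV[OF S])
    have "AE s in lebesgue. s \<in> S \<longrightarrow> c * \<Phi> s \<le> (\<integral>t. k t s \<partial>lebesgue_on \<Omega>0)"
      using k_lower S by (simp add: AE_restrict_space_iff)
    then show "AE s in lebesgue. (if s \<in> S then c * (\<Phi> s * F s) else 0) \<le> (\<integral>t. h t s \<partial>lebesgue)"
    proof eventually_elim
      fix s assume "s \<in> S \<longrightarrow> c * \<Phi> s \<le> (\<integral>t. k t s \<partial>lebesgue_on \<Omega>0)"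
      then show "(if s \<in> S then c * (\<Phi> s * F s) else 0) \<le> (\<integral>t. h t s \<partial>lebesgue)"
        using F(2)[of s] mult_right_mono[of "c * \<Phi> s" "\<integral>t. k t s \<partial>lebesgue_on \<Omega>0" "F s"]
        by (simp add: hs mult_ac)
    qed
  qed (rule fub(2))
  also have "\<dots> = (\<integral>t. \<integral>s. h t s \<partial>lebesgue \<partial>lebesgue)" by (rule fub(3)[symmetric])
  also have "\<dots> = (\<integral>t. \<integral>s. k t s * F s \<partial>lebesgue_on S \<partial>lebesgue_on \<Omega>0)"
    unfolding ht by (rule Lebesgue_Measure.integral_restrict_UNIV[OF O'])
  finally show ?thesis unfolding I_def .
qed

section \<open>Hoelder's inequality against a constant\<close>

text \<open>Integrate Young's inequality for \<open>\<bar>H t\<bar> / a\<close> and 1 at a suitable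
  scale \<open>a\<close>. This form includes \<open>p = 1\<close>.\<close>

lemma integral_abs_le_Lp:
  fixes H :: "'a \<Rightarrow> real"
  assumes "finite_measure M" and p: "1 \<le> p" and H[measurable]: "H \<in> borel_measurable M"
    and int: "integrable M (\<lambda>t. \<bar>H t\<bar> powr p)" and pos: "measure M (space M) > 0"
  shows "(\<integral>t. \<bar>H t\<bar> \<partial>M) \<le> (\<integral>t. \<bar>H t\<bar> powr p \<partial>M) powr (1/p) * measure M (space M) powr (1 - 1/p)"
proof -
  interpret finite_measure M by fact
  define P where "P = (\<integral>t. \<bar>H t\<bar> powr p \<partial>M)"
  define \<mu> where "\<mu> = measure M (space M)"
  have P0: "P \<ge> 0" by (simp add: P_def)
  show ?thesis
  proof (cases "P = 0")
    case True
    then have "AE t in M. \<bar>H t\<bar> powr p = 0"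
      using int by (subst (asm) P_def) (simp add: integral_nonneg_eq_0_iff_AE)
    then have "AE t in M. \<bar>H t\<bar> = 0" by eventually_elim simp
    then have "(\<integral>t. \<bar>H t\<bar> \<partial>M) = (\<integral>t. 0 \<partial>M)" by (intro integral_cong_AE) auto
    then show ?thesis by simp
  next
    case False
    then have Ppos: "P > 0" using P0 by simp
    \<comment> \<open>\<open>a powr p\<close> is the mean of \<open>\<bar>H t\<bar> powr p\<close>;
      with this scale the two integrated terms of \<open>young\<close> add up to exactly
      \<open>a * \<mu>\<close>. For \<open>P = 0\<close> the scale would vanish, hence the case
      split.\<close>
    define a where "a = (P / \<mu>) powr (1/p)"
    have \<mu>: "\<mu> > 0" using pos by (simp add: \<mu>_def)
    have a: "a > 0" "a powr p = P / \<mu>" using Ppos \<mu> p by (auto simp: a_def powr_powr)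
    have young: "y \<le> a / (a powr p * p) * y powr p + a * (1 - 1/p)" if "y \<ge> 0" for y
    proof (cases "y = 0")
      case False
      then have y: "y > 0" using that by simp
      have "((y / a) powr p) powr (1/p) * 1 powr (1 - 1/p) \<le> 1/p * (y / a) powr p + (1 - 1/p) * 1"
        using y a p by (intro Youngs_inequality_0) auto
      then have "y / a \<le> 1/p * (y powr p / a powr p) + (1 - 1/p)"
        using y a(1) p by (simp add: powr_powr powr_divide )
      then have "y / a * a \<le> (1/p * (y powr p / a powr p) + (1 - 1/p)) * a"
        using a by (intro mult_right_mono) auto
      then show ?thesis using a by (simp add: algebra_simps)
    qed (use a p in auto)
    have int2: "integrable M (\<lambda>t. a / (a powr p * p) * \<bar>H t\<bar> powr p + a * (1 - 1/p))"
      using int by simp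
    have "(\<integral>t. \<bar>H t\<bar> \<partial>M) \<le> (\<integral>t. a / (a powr p * p) * \<bar>H t\<bar> powr p + a * (1 - 1/p) \<partial>M)"
    proof (rule integral_mono[OF _ int2])
      show "integrable M (\<lambda>t. \<bar>H t\<bar>)"
      proof (rule Bochner_Integration.integrable_bound[OF int2])
        show "AE t in M. norm \<bar>H t\<bar> \<le> norm (a / (a powr p * p) * \<bar>H t\<bar> powr p + a * (1 - 1/p))"
          by (rule AE_I2, simp only: real_norm_def abs_abs, rule order_trans[OF young abs_ge_self], simp)
      qed measurable
    qed (rule young, simp)
    also have "\<dots> = a / (a powr p * p) * P + a * (1 - 1/p) * \<mu>"
      using int by (simp add: P_def \<mu>_def)
    also have "\<dots> = a * \<mu>" using a Ppos \<mu> p by (simp add: field_simps)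
    also have "a * \<mu> = P powr (1/p) * \<mu> powr (1 - 1/p)"
      using Ppos \<mu> by (simp add: a_def powr_divide powr_diff)
    finally show ?thesis by (simp add: P_def \<mu>_def)
  qed
qed

section \<open>The normalised Hammerstein operator\<close>

text \<open>The hypotheses in the form the proof uses: a compact set \<open>S\<close> for the
  closure of the domain, restricted measures and Bochner integrals. The exponent
  \<open>1 - 1/p\<close> is \<open>1/q\<close> and covers \<open>q = \<infinity>\<close> when
  \<open>p = 1\<close>.\<close>

locale hammerstein =
  fixes S \<Omega>0 :: "'a::euclidean_space set"
    and r \<theta> \<eta>1 \<eta>2 m c p :: real
    and f :: "'a \<Rightarrow> real \<Rightarrow> real"
    and k :: "'a \<Rightarrow> 'a \<Rightarrow> real"
    and g \<Phi> :: "'a \<Rightarrow> real"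
  assumes compact_S: "compact S" and O_sub: "\<Omega>0 \<subseteq> S" and O_sets: "\<Omega>0 \<in> sets lebesgue"
    and O_pos: "measure lebesgue \<Omega>0 > 0"
    and r: "r > 0" and \<theta>: "0 < \<theta>" "\<theta> < 1" and \<eta>: "\<eta>1 > 0" "\<eta>2 > 0" and m: "m > 0" and c: "c > 0" and p: "p \<ge> 1"
    and f_nonneg: "\<And>t u. t \<in> S \<Longrightarrow> u \<in> {-r..r} \<Longrightarrow> 0 \<le> f t u"
    and f_meas: "\<And>u. u \<in> {-r..r} \<Longrightarrow> (\<lambda>t. f t u) \<in> borel_measurable (lebesgue_on S)"
    and f_cont: "AE t in lebesgue_on S. continuous_on {-r..r} (f t)"
    and g_meas: "g \<in> borel_measurable (lebesgue_on S)"
    and g_nonneg: "\<And>t. t \<in> S \<Longrightarrow> 0 \<le> g t"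
    and f_le_g: "AE t in lebesgue_on S. \<forall>u\<in>{-r..r}. f t u \<le> g t"
    and f_lower: "AE t in lebesgue_on \<Omega>0. \<forall>u. \<theta> * m * measure lebesgue \<Omega>0 powr (-1/p) \<le> \<bar>u\<bar> \<and> \<bar>u\<bar> \<le> r \<longrightarrow> \<eta>1 \<le> f t u"
    and k_meas: "set_borel_measurable lebesgue (S \<times> S) (\<lambda>(t, s). k t s)"
    and k_meas2: "\<And>t. t \<in> S \<Longrightarrow> k t \<in> borel_measurable (lebesgue_on S)"
    and k_cont: "\<And>\<tau>. \<tau> \<in> S \<Longrightarrow> ((\<lambda>t. \<integral>s. \<bar>k t s - k \<tau> s\<bar> * g s \<partial>lebesgue_on S) \<longlongrightarrow> 0) (at \<tau> within S)"
    and \<Phi>_meas: "\<Phi> \<in> borel_measurable (lebesgue_on S)"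
    and \<Phi>_nonneg: "\<And>t. t \<in> S \<Longrightarrow> 0 \<le> \<Phi> t"
    and \<Phi>_lower: "AE t in lebesgue_on \<Omega>0. \<eta>2 \<le> \<Phi> t"
    and k_bound: "\<And>t. t \<in> S \<Longrightarrow> AE s in lebesgue_on S. \<bar>k t s\<bar> \<le> \<Phi> s"
    and k_lower: "AE s in lebesgue_on S. c * \<Phi> s \<le> (\<integral>t. k t s \<partial>lebesgue_on \<Omega>0)"
    and \<Phi>g_int: "integrable (lebesgue_on S) (\<lambda>s. \<Phi> s * g s)"
    and m_le: "m \<le> r * c * measure lebesgue \<Omega>0 powr (-(1 - 1/p))"
begin

abbreviation "\<mu> \<equiv> measure lebesgue \<Omega>0"

definition "D = {x. continuous_on S x \<and> x ` S \<subseteq> {-r..r}}"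
definition "T x t = (\<integral>s. k t s * f s (x s) \<partial>lebesgue_on S)"
text \<open>\<open>I x\<close> replaces the supremum of \<open>\<bar>T x\<bar>\<close>: it dominates
  every value of \<open>T x\<close>, while \<open>c * I x\<close> is still below the integral of
  \<open>T x\<close> over \<open>\<Omega>0\<close>.\<close>

definition "I x = (\<integral>s. \<Phi> s * f s (x s) \<partial>lebesgue_on S)"
definition "N x = (\<integral>t. \<bar>x t\<bar> powr p \<partial>lebesgue_on \<Omega>0)"
text \<open>The penalty \<open>e\<close> vanishes once \<open>x\<close> has \<open>L\<^sup>p\<close> norm \<open>m\<close>, and otherwise keeps \<open>H x\<close> away from \<open>0\<close>.\<close>

definition "e x = max 0 (m powr p - N x)"
definition "H x t = T x t + e x"
definition "Z x = (\<integral>t. \<bar>H x t\<bar> powr p \<partial>lebesgue_on \<Omega>0) powr (1/p)"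
definition "G x t = m * H x t / Z x"

section \<open>Measurability and integrability\<close>

lemma S_sets: "S \<in> sets lebesgue"
  using compact_S by (simp add: lmeasurable_compact fmeasurableD)

lemma O_lmeasurable: "\<Omega>0 \<in> lmeasurable"
  using fmeasurableI2[OF lmeasurable_compact[OF compact_S] O_sub O_sets] .

lemma finite_measure_O: "finite_measure (lebesgue_on \<Omega>0)"
  by (rule finite_measure_lebesgue_on[OF O_lmeasurable])

lemma measure_space_O [simp]: "measure (lebesgue_on \<Omega>0) \<Omega>0 = \<mu>"
  using O_sets by (simp add: measure_restrict_space)

lemma continuous_measurable_S: "continuous_on S x \<Longrightarrow> x \<in> borel_measurable (lebesgue_on S)"
  by (rule continuous_imp_measurable_on_sets_lebesgue[OF _ S_sets])

lemma continuous_measurable_O: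
  assumes "continuous_on S x"
  shows "x \<in> borel_measurable (lebesgue_on \<Omega>0)"
  by (rule continuous_imp_measurable_on_sets_lebesgue) (use assms O_sub O_sets continuous_on_subset in auto)

lemma D_range: "x \<in> D \<Longrightarrow> t \<in> S \<Longrightarrow> x t \<in> {-r..r}"
  by (auto simp: D_def)

lemma f_superposition_meas:
  assumes "x \<in> D"
  shows "(\<lambda>s. f s (x s)) \<in> borel_measurable (lebesgue_on S)"
  by (rule borel_measurable_caratheodory_superposition_AE[OF complete_measure_lebesgue_on[OF S_sets] f_meas f_cont])
     (use assms D_range in \<open>auto simp: D_def intro: continuous_measurable_S\<close>)

lemma f_superposition_nonneg: "x \<in> D \<Longrightarrow> s \<in> S \<Longrightarrow> 0 \<le> f s (x s)"
  by (auto intro: f_nonneg D_range)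

lemma f_superposition_le:
  assumes "x \<in> D"
  shows "AE s in lebesgue_on S. f s (x s) \<le> g s"
  using f_le_g AE_space by eventually_elim (use assms D_range in auto)

lemma kg_int:
  assumes "t \<in> S"
  shows "integrable (lebesgue_on S) (\<lambda>s. k t s * g s)"
proof (rule Bochner_Integration.integrable_bound[OF \<Phi>g_int])
  show "(\<lambda>s. k t s * g s) \<in> borel_measurable (lebesgue_on S)"
    using k_meas2[OF assms] g_meas by measurable
  show "AE s in lebesgue_on S. norm (k t s * g s) \<le> norm (\<Phi> s * g s)"
    using k_bound[OF assms] AE_space
    by eventually_elim (auto simp: abs_mult g_nonneg \<Phi>_nonneg intro!: mult_right_mono)
qed

lemma kf_bound:
  assumes "x \<in> D" "t \<in> S"
  shows "AE s in lebesgue_on S. norm (k t s * f s (x s)) \<le> \<Phi> s * g s"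
  using f_superposition_le[OF assms(1)] k_bound[OF assms(2)] AE_space
  by eventually_elim
     (auto simp: abs_mult g_nonneg \<Phi>_nonneg f_superposition_nonneg assms intro!: mult_mono)

lemma kf_meas:
  assumes "x \<in> D" "t \<in> S"
  shows "(\<lambda>s. k t s * f s (x s)) \<in> borel_measurable (lebesgue_on S)"
  using k_meas2[OF assms(2)] f_superposition_meas[OF assms(1)] by measurable

lemma kf_int:
  assumes "x \<in> D" "t \<in> S"
  shows "integrable (lebesgue_on S) (\<lambda>s. k t s * f s (x s))"
  by (rule Bochner_Integration.integrable_bound[OF \<Phi>g_int kf_meas[OF assms]])
     (use kf_bound[OF assms] in \<open>auto elim!: eventually_mono\<close>)

lemma \<Phi>f_int:
  assumes "x \<in> D"
  shows "integrable (lebesgue_on S) (\<lambda>s. \<Phi> s * f s (x s))"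
proof (rule Bochner_Integration.integrable_bound[OF \<Phi>g_int])
  show "(\<lambda>s. \<Phi> s * f s (x s)) \<in> borel_measurable (lebesgue_on S)"
    using \<Phi>_meas f_superposition_meas[OF assms] by measurable
  show "AE s in lebesgue_on S. norm (\<Phi> s * f s (x s)) \<le> norm (\<Phi> s * g s)"
    using f_superposition_le[OF assms] AE_space
    by eventually_elim (auto simp: abs_mult g_nonneg \<Phi>_nonneg f_superposition_nonneg assms intro!: mult_mono)
qed

section \<open>Bounds and equicontinuity for \<open>T\<close>\<close>

lemma I_nonneg: "x \<in> D \<Longrightarrow> 0 \<le> I x"
  unfolding I_def by (rule integral_nonneg_AE, rule AE_I2) (auto simp: \<Phi>_nonneg f_superposition_nonneg)

lemma I_le:
  assumes "x \<in> D"
  shows "I x \<le> (\<integral>s. \<Phi> s * g s \<partial>lebesgue_on S)"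
  unfolding I_def
proof (rule integral_mono_AE[OF \<Phi>f_int[OF assms] \<Phi>g_int])
  show "AE s in lebesgue_on S. \<Phi> s * f s (x s) \<le> \<Phi> s * g s"
    using f_superposition_le[OF assms] AE_space
    by eventually_elim (auto simp: \<Phi>_nonneg intro!: mult_left_mono)
qed

lemma T_le_I:
  assumes "x \<in> D" "t \<in> S"
  shows "\<bar>T x t\<bar> \<le> I x"
proof -
  have "\<bar>T x t\<bar> \<le> (\<integral>s. \<bar>k t s * f s (x s)\<bar> \<partial>lebesgue_on S)"
    unfolding T_def by (rule integral_abs_bound)
  also have "\<dots> \<le> I x"
    unfolding I_def
  proof (rule integral_mono_AE[OF _ \<Phi>f_int[OF assms(1)]])
    show "AE s in lebesgue_on S. \<bar>k t s * f s (x s)\<bar> \<le> \<Phi> s * f s (x s)"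
      using k_bound[OF assms(2)] AE_space
      by eventually_elim (auto simp: abs_mult f_superposition_nonneg assms intro!: mult_right_mono)
  qed (use kf_int[OF assms] in auto)
  finally show ?thesis .
qed

text \<open>The bound does not involve \<open>x\<close>, so it gives equicontinuity of the whole
  family.\<close>

lemma T_diff_le:
  assumes "x \<in> D" "t \<in> S" "\<tau> \<in> S"
  shows "\<bar>T x t - T x \<tau>\<bar> \<le> (\<integral>s. \<bar>k t s - k \<tau> s\<bar> * g s \<partial>lebesgue_on S)"
proof -
  have "T x t - T x \<tau> = (\<integral>s. k t s * f s (x s) - k \<tau> s * f s (x s) \<partial>lebesgue_on S)"
    unfolding T_def using kf_int assms by (subst Bochner_Integration.integral_diff) auto
  also have "\<bar>\<dots>\<bar> \<le> (\<integral>s. \<bar>k t s * f s (x s) - k \<tau> s * f s (x s)\<bar> \<partial>lebesgue_on S)"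
    by (rule integral_abs_bound)
  also have "\<dots> \<le> (\<integral>s. \<bar>k t s - k \<tau> s\<bar> * g s \<partial>lebesgue_on S)"
  proof (rule integral_mono_AE)
    show "integrable (lebesgue_on S) (\<lambda>s. \<bar>k t s * f s (x s) - k \<tau> s * f s (x s)\<bar>)"
      using kf_int assms by auto
    have "integrable (lebesgue_on S) (\<lambda>s. \<bar>k t s * g s - k \<tau> s * g s\<bar>)"
      using kg_int assms by auto
    then show "integrable (lebesgue_on S) (\<lambda>s. \<bar>k t s - k \<tau> s\<bar> * g s)"
      by (rule Bochner_Integration.integrable_cong[THEN iffD1, rotated 2])
         (auto simp: abs_mult g_nonneg left_diff_distrib[symmetric])
    show "AE s in lebesgue_on S. \<bar>k t s * f s (x s) - k \<tau> s * f s (x s)\<bar> \<le> \<bar>k t s - k \<tau> s\<bar> * g s"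
      using f_superposition_le[OF assms(1)] AE_space
      by eventually_elim
         (auto simp: abs_mult f_superposition_nonneg assms left_diff_distrib[symmetric] intro!: mult_left_mono)
  qed
  finally show ?thesis .
qed

lemma kernel_modulus:
  assumes "\<tau> \<in> S" "\<epsilon> > 0"
  obtains d where "d > 0" "\<And>t. t \<in> S \<Longrightarrow> dist t \<tau> < d \<Longrightarrow> (\<integral>s. \<bar>k t s - k \<tau> s\<bar> * g s \<partial>lebesgue_on S) < \<epsilon>"
proof -
  have "\<forall>\<^sub>F t in at \<tau> within S. (\<integral>s. \<bar>k t s - k \<tau> s\<bar> * g s \<partial>lebesgue_on S) < \<epsilon>"
    by (rule order_tendstoD(2)[OF k_cont[OF assms(1)] assms(2)])
  then obtain d where "d > 0" "\<And>t. t \<in> S \<Longrightarrow> t \<noteq> \<tau> \<Longrightarrow> dist t \<tau> < d \<Longrightarrow> (\<integral>s. \<bar>k t s - k \<tau> s\<bar> * g s \<partial>lebesgue_on S) < \<epsilon>"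
    by (auto simp: eventually_at)
  \<comment> \<open>The punctured limit is silent at \<open>t = \<tau>\<close>, but there the
    integrand vanishes.\<close>
  then show ?thesis using that[of d] assms(2) by (metis (mono_tags, lifting) Bochner_Integration.integral_cong abs_zero
     cancel_comm_monoid_add_class.diff_cancel integral_zero mult_zero_left)
qed

lemma T_continuous:
  assumes "x \<in> D"
  shows "continuous_on S (T x)"
proof (rule continuous_onI)
  fix \<tau> and \<epsilon> :: real assume \<tau>: "\<tau> \<in> S" and \<epsilon>: "\<epsilon> > 0"
  obtain d where "d > 0" "\<And>t. t \<in> S \<Longrightarrow> dist t \<tau> < d \<Longrightarrow> (\<integral>s. \<bar>k t s - k \<tau> s\<bar> * g s \<partial>lebesgue_on S) < \<epsilon>"
    by (rule kernel_modulus[OF \<tau> \<epsilon>]) blast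
  then show "\<exists>d>0. \<forall>t\<in>S. dist t \<tau> < d \<longrightarrow> dist (T x t) (T x \<tau>) \<le> \<epsilon>"
    using T_diff_le[OF assms _ \<tau>] by (force simp: dist_real_def intro!: exI[of _ d])
qed

lemma H_continuous: "x \<in> D \<Longrightarrow> continuous_on S (H x)"
  unfolding H_def[abs_def] by (intro continuous_intros T_continuous)

section \<open>The cone condition\<close>

lemma integral_T_lower:
  assumes "x \<in> D"
  shows "c * I x \<le> (\<integral>t. T x t \<partial>lebesgue_on \<Omega>0)"
  unfolding I_def T_def
  by (rule kernel_Fubini_lower_bound[OF S_sets O_lmeasurable O_sub k_meas k_bound k_lower])
     (use assms f_superposition_meas f_superposition_nonneg \<Phi>f_int in auto)

text \<open>Test the lower bound for the kernel against the weight \<open>1 / (1 + \<Phi>)\<close>.\<close>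

lemma c_le_measure: "c \<le> \<mu>"
proof -
  \<comment> \<open>Dividing by \<open>1 + \<Phi>\<close> bounds \<open>\<Phi> * F\<close> by 1, so
    it is integrable without any assumption on the integral of \<open>\<Phi>\<close>. The bound
    \<open>\<Phi> \<ge> \<eta>2\<close> on \<open>\<Omega>0\<close> keeps \<open>J\<close> positive,
    so \<open>J\<close> cancels from \<open>c * J \<le> \<mu> * J\<close>.\<close>
  define F where "F s = indicat_real \<Omega>0 s / (1 + \<Phi> s)" for s
  define J where "J = (\<integral>s. \<Phi> s * F s \<partial>lebesgue_on S)"
  have F0: "0 \<le> F s" if "s \<in> S" for s using \<Phi>_nonneg[OF that] by (simp add: F_def)
  have O_meas: "indicat_real \<Omega>0 \<in> borel_measurable (lebesgue_on S)"
    using O_sets by (intro measurable_restrict_space1) simp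
  have Fm: "F \<in> borel_measurable (lebesgue_on S)"
    unfolding F_def using O_meas \<Phi>_meas by measurable
  have le1: "\<Phi> s * F s \<le> 1" "0 \<le> \<Phi> s * F s" if "s \<in> S" for s
    using \<Phi>_nonneg[OF that] by (auto simp: F_def indicator_def)
  interpret S: finite_measure "lebesgue_on S"
    by (rule finite_measure_lebesgue_on) (rule lmeasurable_compact[OF compact_S])
  have int: "integrable (lebesgue_on S) (\<lambda>s. \<Phi> s * F s)"
    by (rule S.integrable_const_bound[of _ 1])
       (use le1 \<Phi>_meas Fm in \<open>auto intro!: AE_I2\<close>)
  have kF: "\<bar>\<integral>s. k t s * F s \<partial>lebesgue_on S\<bar> \<le> J" if t: "t \<in> S" for t
  proof -
    have ae: "AE s in lebesgue_on S. norm (k t s * F s) \<le> \<Phi> s * F s"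
      using k_bound[OF t] AE_space by eventually_elim (auto simp: abs_mult F0 intro!: mult_right_mono)
    have "integrable (lebesgue_on S) (\<lambda>s. k t s * F s)"
      by (rule Bochner_Integration.integrable_bound[OF int])
         (use ae k_meas2[OF t] Fm in \<open>auto elim!: eventually_mono\<close>)
    then show ?thesis
      unfolding J_def
      by (intro order_trans[OF integral_abs_bound integral_mono_AE]) (use int ae in auto)
  qed
  have "c * J \<le> (\<integral>t. \<integral>s. k t s * F s \<partial>lebesgue_on S \<partial>lebesgue_on \<Omega>0)"
    unfolding J_def
    by (rule kernel_Fubini_lower_bound[OF S_sets O_lmeasurable O_sub k_meas k_bound k_lower Fm F0 int])
  also have "\<dots> \<le> (\<integral>t. J \<partial>lebesgue_on \<Omega>0)"
  proof -
    interpret O: finite_measure "lebesgue_on \<Omega>0" by (rule finite_measure_O)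
    have "0 \<le> J" unfolding J_def by (rule integral_nonneg_AE, rule AE_I2) (use le1 in auto)
    then show ?thesis
      by (intro integral_mono_AE') (use kF O_sub in \<open>auto intro!: AE_I2 simp: abs_le_iff\<close>)
  qed
  also have "\<dots> = \<mu> * J" by simp
  finally have cJ: "c * J \<le> \<mu> * J" .
  have "J > 0"
  proof -
    have ae: "AE s in lebesgue_on \<Omega>0. \<eta>2 / (1 + \<eta>2) \<le> \<Phi> s * F s"
      using \<Phi>_lower AE_space by eventually_elim (use \<eta> O_sub in \<open>auto simp: F_def field_simps\<close>)
    have "\<mu> * (\<eta>2 / (1 + \<eta>2)) = (\<integral>s. \<eta>2 / (1 + \<eta>2) \<partial>lebesgue_on \<Omega>0)" by simp
    also have "\<dots> \<le> J" unfolding J_def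
      by (rule integral_mono_lebesgue_on_AE[OF int ae]) (use le1 O_sub O_sets S_sets in \<open>auto intro!: AE_I2\<close>)
    finally show ?thesis using O_pos \<eta> by (smt (verit) divide_pos_pos mult_pos_pos)
  qed
  then show ?thesis using cJ by simp
qed

section \<open>The penalised operator \<open>H\<close>\<close>

lemma e_nonneg: "0 \<le> e x" by (simp add: e_def)

lemma H_le: "x \<in> D \<Longrightarrow> t \<in> S \<Longrightarrow> \<bar>H x t\<bar> \<le> I x + e x"
  using T_le_I[of x t] e_nonneg[of x] by (simp add: H_def)

lemma xp_le: "x \<in> D \<Longrightarrow> t \<in> S \<Longrightarrow> \<bar>x t\<bar> powr p \<le> r powr p"
  using D_range[of x t] p by (intro powr_mono2) auto

lemma xp_int:
  assumes "x \<in> D"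
  shows "integrable (lebesgue_on \<Omega>0) (\<lambda>t. \<bar>x t\<bar> powr p)"
proof -
  interpret O: finite_measure "lebesgue_on \<Omega>0" by (rule finite_measure_O)
  have [measurable]: "x \<in> borel_measurable (lebesgue_on \<Omega>0)"
    using assms by (auto simp: D_def intro: continuous_measurable_O)
  show ?thesis
    by (rule O.integrable_const_bound[of _ "r powr p"])
       (use xp_le[OF assms] O_sub in \<open>auto intro!: AE_I2\<close>)
qed

lemma T_int:
  assumes "x \<in> D"
  shows "integrable (lebesgue_on \<Omega>0) (T x)"
proof -
  interpret O: finite_measure "lebesgue_on \<Omega>0" by (rule finite_measure_O)
  show ?thesis
    by (rule O.integrable_const_bound[of _ "I x"])
       (use T_le_I[OF assms] O_sub T_continuous[OF assms] in \<open>auto intro!: AE_I2 continuous_measurable_O\<close>)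
qed

lemma Hp_int:
  assumes "x \<in> D"
  shows "integrable (lebesgue_on \<Omega>0) (\<lambda>t. \<bar>H x t\<bar> powr p)"
proof -
  interpret O: finite_measure "lebesgue_on \<Omega>0" by (rule finite_measure_O)
  have [measurable]: "H x \<in> borel_measurable (lebesgue_on \<Omega>0)"
    using H_continuous[OF assms] by (rule continuous_measurable_O)
  have "\<bar>H x t\<bar> powr p \<le> (I x + e x) powr p" if "t \<in> S" for t
    using H_le[OF assms that] p by (intro powr_mono2) auto
  then show ?thesis
    by (intro O.integrable_const_bound[of _ "(I x + e x) powr p"])
       (use O_sub in \<open>auto intro!: AE_I2\<close>)
qed

text \<open>Adding the constant \<open>e x\<close> preserves the cone condition because
  \<open>c \<le> \<mu>\<close>.\<close>

lemma integral_H_lower: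
  assumes "x \<in> D"
  shows "c * (I x + e x) \<le> (\<integral>t. \<bar>H x t\<bar> \<partial>lebesgue_on \<Omega>0)"
proof -
  interpret O: finite_measure "lebesgue_on \<Omega>0" by (rule finite_measure_O)
  have H_int: "integrable (lebesgue_on \<Omega>0) (H x)"
    unfolding H_def[abs_def] using T_int[OF assms] by simp
  have "c * (I x + e x) \<le> (\<integral>t. T x t \<partial>lebesgue_on \<Omega>0) + \<mu> * e x"
    using integral_T_lower[OF assms] mult_right_mono[OF c_le_measure e_nonneg[of x]]
    by (simp add: distrib_left)
  also have "\<dots> = (\<integral>t. H x t \<partial>lebesgue_on \<Omega>0)"
    unfolding H_def using T_int[OF assms] by simp
  also have "\<dots> \<le> (\<integral>t. \<bar>H x t\<bar> \<partial>lebesgue_on \<Omega>0)"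
    by (rule integral_mono) (use H_int in auto)
  finally show ?thesis .
qed

text \<open>The \<open>p\<close>-th power of the threshold for \<open>\<bar>u\<bar>\<close> has
  integral \<open>(\<theta> * m) powr p\<close> over \<open>\<Omega>0\<close>. The remaining
  \<open>(1 - \<theta> powr p) * m powr p\<close> has to be supplied by \<open>I x\<close> or by
  \<open>e x\<close>, up to the factor in front.\<close>

definition "b0 = min 1 (\<eta>1 * \<eta>2 / r powr p) * (1 - \<theta> powr p) * m powr p"

lemma b0_pos: "b0 > 0"
proof -
  have "\<theta> powr p < 1" using powr_less_mono2[of p \<theta> 1] \<theta> p by simp
  then show ?thesis using \<eta> r m by (simp add: b0_def)
qed

text \<open>Pointwise on \<open>\<Omega>0\<close>, the product \<open>\<Phi> t * f t (x t)\<close> dominates a multiple of the excess of \<open>\<bar>x t\<bar> powr p\<close>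
  over the \<open>p\<close>-th power of the threshold in the hypothesis on \<open>f\<close>.\<close>

lemma b0_le:
  assumes "x \<in> D"
  shows "b0 \<le> I x + e x"
proof -
  interpret O: finite_measure "lebesgue_on \<Omega>0" by (rule finite_measure_O)
  \<comment> \<open>Chosen so that \<open>q * r powr p = \<eta>1 * \<eta>2\<close>, the lower bound
    for \<open>\<Phi> t * f t (x t)\<close> above the threshold.\<close>
  define q where "q = \<eta>1 * \<eta>2 / r powr p"
  have q: "q > 0" using \<eta> r by (simp add: q_def)
  define w where "w = (\<theta> * m) powr p / \<mu>"
  have thr: "(\<theta> * m * \<mu> powr (-1/p)) powr p = w"
  proof -
    have "(\<mu> powr (-1/p)) powr p = \<mu> powr (-1)" using p by (simp only: powr_powr) simp
    then show ?thesis using \<theta> m O_pos by (simp add: w_def powr_mult powr_minus divide_inverse)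
  qed
  have ae: "AE t in lebesgue_on \<Omega>0. q * (\<bar>x t\<bar> powr p - w) \<le> \<Phi> t * f t (x t)"
    using f_lower \<Phi>_lower AE_space
  proof eventually_elim
    fix t assume low: "\<forall>u. \<theta> * m * \<mu> powr (-1/p) \<le> \<bar>u\<bar> \<and> \<bar>u\<bar> \<le> r \<longrightarrow> \<eta>1 \<le> f t u" and \<Phi>: "\<eta>2 \<le> \<Phi> t"
      and "t \<in> space (lebesgue_on \<Omega>0)"
    then have t: "t \<in> S" using O_sub by auto
    have xr: "\<bar>x t\<bar> \<le> r" using D_range[OF assms t] by auto
    show "q * (\<bar>x t\<bar> powr p - w) \<le> \<Phi> t * f t (x t)"
    proof (cases "\<theta> * m * \<mu> powr (-1/p) \<le> \<bar>x t\<bar>")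
      case True
      then have "\<eta>1 \<le> f t (x t)" using low xr by blast
      then have "\<eta>2 * \<eta>1 \<le> \<Phi> t * f t (x t)" using \<Phi> \<eta> by (intro mult_mono) auto
      moreover have "q * (\<bar>x t\<bar> powr p - w) \<le> q * r powr p"
        using q xp_le[OF assms t] \<theta> m O_pos by (intro mult_left_mono) (auto simp: w_def intro: order_trans[rotated])
      ultimately show ?thesis using r by (simp add: q_def mult.commute)
    next
      case False
      then have "\<bar>x t\<bar> powr p \<le> w" unfolding thr[symmetric] using p by (intro powr_mono2) auto
      then have "q * (\<bar>x t\<bar> powr p - w) \<le> 0" using q by (simp add: mult_nonneg_nonpos)
      also have "0 \<le> \<Phi> t * f t (x t)" using \<Phi>_nonneg[OF t] f_superposition_nonneg[OF assms t] by simp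
      finally show ?thesis .
    qed
  qed
  have "(\<integral>t. q * (\<bar>x t\<bar> powr p - w) \<partial>lebesgue_on \<Omega>0) \<le> I x"
    unfolding I_def
    by (rule integral_mono_lebesgue_on_AE[OF \<Phi>f_int[OF assms] ae])
       (use \<Phi>_nonneg f_superposition_nonneg[OF assms] O_sub O_sets S_sets in \<open>auto intro!: AE_I2\<close>)
  moreover have "(\<integral>t. q * (\<bar>x t\<bar> powr p - w) \<partial>lebesgue_on \<Omega>0) = q * (N x - (\<theta> * m) powr p)"
    using xp_int[OF assms] O_pos by (simp add: N_def w_def)
  ultimately have I: "q * (N x - \<theta> powr p * m powr p) \<le> I x"
    using \<theta> m q by (auto simp: powr_mult)
  \<comment> \<open>A single factor that works for both \<open>I x\<close> and \<open>e x\<close>: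
    in the sum of the two lower bounds \<open>N x\<close> cancels and \<open>b0\<close>
    remains.\<close>
  define \<kappa> where "\<kappa> = min 1 q"
  have \<kappa>: "0 < \<kappa>" "\<kappa> \<le> 1" "\<kappa> \<le> q" using q by (auto simp: \<kappa>_def)
  have "\<kappa> * (N x - \<theta> powr p * m powr p) \<le> I x"
  proof (cases "N x - \<theta> powr p * m powr p \<ge> 0")
    case True
    then show ?thesis using I mult_right_mono[OF \<kappa>(3) True] by linarith
  next
    case False
    then have "\<kappa> * (N x - \<theta> powr p * m powr p) \<le> 0" using \<kappa> by (simp add: mult_nonneg_nonpos)
    then show ?thesis using I_nonneg[OF assms] by linarith
  qed
  moreover have "\<kappa> * (m powr p - N x) \<le> e x"
  proof -
    have "\<kappa> * (m powr p - N x) \<le> \<kappa> * e x" using \<kappa> by (intro mult_left_mono) (auto simp: e_def)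
    also have "\<dots> \<le> e x" using \<kappa> e_nonneg[of x] by (simp add: mult_left_le_one_le)
    finally show ?thesis .
  qed
  moreover have "b0 = \<kappa> * (N x - \<theta> powr p * m powr p) + \<kappa> * (m powr p - N x)"
    by (simp add: b0_def \<kappa>_def q_def algebra_simps)
  ultimately show ?thesis by linarith
qed

section \<open>The normalising factor and the operator \<open>G\<close>\<close>

lemma Z_lower:
  assumes "x \<in> D"
  shows "c * (I x + e x) \<le> Z x * \<mu> powr (1 - 1/p)"
proof -
  have "(\<integral>t. \<bar>H x t\<bar> \<partial>lebesgue_on \<Omega>0) \<le> Z x * \<mu> powr (1 - 1/p)"
    using integral_abs_le_Lp[OF finite_measure_O p _ Hp_int[OF assms]] O_pos
      continuous_measurable_O[OF H_continuous[OF assms]]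
    by (simp add: Z_def)
  with integral_H_lower[OF assms] show ?thesis by linarith
qed

text \<open>A lower bound for \<open>Z x\<close> independent of \<open>x\<close>; equicontinuity of
  \<open>G\<close> rests on this uniformity.\<close>

definition "Z0 = c * b0 / \<mu> powr (1 - 1/p)"

lemma Z0_pos: "Z0 > 0"
  using c b0_pos O_pos by (simp add: Z0_def)

lemma Z0_le: "x \<in> D \<Longrightarrow> Z0 \<le> Z x"
  using order_trans[OF mult_left_mono[OF b0_le, of x c] Z_lower] c O_pos by (simp add: Z0_def divide_le_eq)

lemma Z_pos: "x \<in> D \<Longrightarrow> Z x > 0"
  using Z0_le[of x] Z0_pos by linarith

text \<open>Here \<open>m_le\<close> enters: \<open>\<bar>H x t\<bar> \<le> I x + e x\<close> and
  \<open>Z_lower\<close> bound \<open>\<bar>H x t\<bar> / Z x\<close> by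
  \<open>\<mu> powr (1 - 1/p) / c\<close>, and \<open>m\<close> times this is at most
  \<open>r\<close>.\<close>

lemma G_range:
  assumes "x \<in> D" "t \<in> S"
  shows "G x t \<in> {-r..r}"
proof -
  have "m \<le> r * c / \<mu> powr (1 - 1/p)"
    using m_le by (simp only: powr_minus divide_inverse)
  then have "m * \<mu> powr (1 - 1/p) \<le> r * c"
    using O_pos by (simp add: pos_le_divide_eq)
  have "m * \<bar>H x t\<bar> * c \<le> m * (c * (I x + e x))"
    using H_le[OF assms] m c by (simp add: mult_ac)
  also have "\<dots> \<le> m * (Z x * \<mu> powr (1 - 1/p))"
    using Z_lower[OF assms(1)] m by (intro mult_left_mono) auto
  also have "\<dots> = (m * \<mu> powr (1 - 1/p)) * Z x" by simp
  also have "\<dots> \<le> (r * c) * Z x"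
    using \<open>m * \<mu> powr (1 - 1/p) \<le> r * c\<close> Z_pos[OF assms(1)] by (intro mult_right_mono) auto
  finally have "m * \<bar>H x t\<bar> \<le> r * Z x" using c by (simp add: mult.commute mult.left_commute)
  then have "\<bar>G x t\<bar> \<le> r"
    using Z_pos[OF assms(1)] m by (simp add: G_def abs_mult abs_divide divide_le_eq)
  then show ?thesis by auto
qed

lemma G_equicontinuous:
  assumes "\<tau> \<in> S" "\<epsilon> > 0"
  shows "\<exists>d>0. \<forall>x\<in>D. \<forall>t\<in>S. dist t \<tau> < d \<longrightarrow> \<bar>G x t - G x \<tau>\<bar> < \<epsilon>"
proof -
  have "\<epsilon> * Z0 / m > 0" using assms Z0_pos m by simp
  from kernel_modulus[OF assms(1) this] obtain d where d: "d > 0"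
    "\<And>t. t \<in> S \<Longrightarrow> dist t \<tau> < d \<Longrightarrow> (\<integral>s. \<bar>k t s - k \<tau> s\<bar> * g s \<partial>lebesgue_on S) < \<epsilon> * Z0 / m"
    by blast
  have "\<bar>G x t - G x \<tau>\<bar> < \<epsilon>" if "x \<in> D" "t \<in> S" "dist t \<tau> < d" for x t
  proof -
    have "\<bar>T x t - T x \<tau>\<bar> < \<epsilon> * Z0 / m"
      using T_diff_le[OF that(1,2) assms(1)] d(2)[OF that(2,3)] by linarith
    then have "m * \<bar>T x t - T x \<tau>\<bar> < \<epsilon> * Z0" using m by (simp add: field_simps)
    also have "\<dots> \<le> \<epsilon> * Z x" using Z0_le[OF that(1)] assms(2) by simp
    finally have "m * \<bar>T x t - T x \<tau>\<bar> / Z x < \<epsilon>" using Z_pos[OF that(1)] by (simp add: divide_less_eq)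
    \<comment> \<open>The penalty \<open>e x\<close> is constant in \<open>t\<close> and drops out
      of the difference.\<close>
    moreover have "G x t - G x \<tau> = m * (T x t - T x \<tau>) / Z x"
      by (simp add: G_def H_def diff_divide_distrib[symmetric] algebra_simps)
    ultimately show ?thesis using m Z_pos[OF that(1)] by (simp add: abs_mult abs_divide)
  qed
  with d(1) show ?thesis by blast
qed

lemma tendsto_abs_powr:
  fixes X :: "nat \<Rightarrow> real"
  assumes "X \<longlonglongrightarrow> a"
  shows "(\<lambda>j. \<bar>X j\<bar> powr p) \<longlonglongrightarrow> \<bar>a\<bar> powr p"
  using p by (intro tendsto_powr2 tendsto_intros assms) auto

text \<open>Dominated convergence three times: for \<open>T\<close> with majorant
  \<open>\<Phi> s * g s\<close>, for \<open>N\<close> with \<open>r powr p\<close>, and for the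
  integral in \<open>Z\<close> with \<open>B powr p\<close>.\<close>

lemma G_pointwise_limit:
  assumes X: "\<And>j::nat. X j \<in> D" and x: "x \<in> D" and lim: "\<And>t. t \<in> S \<Longrightarrow> (\<lambda>j. X j t) \<longlonglongrightarrow> x t"
    and t: "t \<in> S"
  shows "(\<lambda>j. G (X j) t) \<longlonglongrightarrow> G x t"
proof -
  interpret O: finite_measure "lebesgue_on \<Omega>0" by (rule finite_measure_O)
  have T: "(\<lambda>j. T (X j) t) \<longlonglongrightarrow> T x t" if t: "t \<in> S" for t
    unfolding T_def
  proof (rule integral_dominated_convergence[OF kf_meas[OF x t] kf_meas[OF X t] \<Phi>g_int _ kf_bound[OF X t]])
    show "AE s in lebesgue_on S. (\<lambda>j. k t s * f s (X j s)) \<longlonglongrightarrow> k t s * f s (x s)"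
      using f_cont AE_space
    proof eventually_elim
      fix s assume c: "continuous_on {-r..r} (f s)" and "s \<in> space (lebesgue_on S)"
      then have s: "s \<in> S" by simp
      have "(\<lambda>j. f s (X j s)) \<longlonglongrightarrow> f s (x s)"
        by (rule continuous_on_tendsto_compose[OF c lim[OF s] D_range[OF x s]]) (use D_range[OF X s] in auto)
      then show "(\<lambda>j. k t s * f s (X j s)) \<longlonglongrightarrow> k t s * f s (x s)" by (intro tendsto_intros)
    qed
  qed
  have "(\<lambda>j. N (X j)) \<longlonglongrightarrow> N x"
    unfolding N_def
  proof (rule integral_dominated_convergence[of _ _ _ "\<lambda>_. r powr p"])
    show "AE t in lebesgue_on \<Omega>0. (\<lambda>j. \<bar>X j t\<bar> powr p) \<longlonglongrightarrow> \<bar>x t\<bar> powr p"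
      using O_sub by (intro AE_I2 tendsto_abs_powr lim) auto
    show "AE t in lebesgue_on \<Omega>0. norm (\<bar>X j t\<bar> powr p) \<le> r powr p" for j
      using O_sub xp_le[OF X] by (intro AE_I2) auto
  qed (use xp_int[OF x] xp_int[OF X] in auto)
  then have e: "(\<lambda>j. e (X j)) \<longlonglongrightarrow> e x" unfolding e_def by (intro tendsto_intros)
  have H: "(\<lambda>j. H (X j) t) \<longlonglongrightarrow> H x t" if "t \<in> S" for t
    unfolding H_def by (intro tendsto_intros T e that)
  define B where "B = (\<integral>s. \<Phi> s * g s \<partial>lebesgue_on S) + m powr p"
  have HB: "\<bar>H y t\<bar> \<le> B" if "y \<in> D" "t \<in> S" for y t
  proof -
    have "0 \<le> N y" unfolding N_def by simp
    then have "e y \<le> m powr p" by (simp add: e_def)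
    then show ?thesis using H_le[OF that] I_le[OF that(1)] by (simp add: B_def)
  qed
  have P: "(\<lambda>j. \<integral>t. \<bar>H (X j) t\<bar> powr p \<partial>lebesgue_on \<Omega>0) \<longlonglongrightarrow> (\<integral>t. \<bar>H x t\<bar> powr p \<partial>lebesgue_on \<Omega>0)"
  proof (rule integral_dominated_convergence[of _ _ _ "\<lambda>_. B powr p"])
    show "AE t in lebesgue_on \<Omega>0. (\<lambda>j. \<bar>H (X j) t\<bar> powr p) \<longlonglongrightarrow> \<bar>H x t\<bar> powr p"
      using O_sub by (intro AE_I2 tendsto_abs_powr H) auto
    have "\<bar>H (X j) t\<bar> powr p \<le> B powr p" if "t \<in> S" for j t
      using HB[OF X that] p by (intro powr_mono2) auto
    then show "AE t in lebesgue_on \<Omega>0. norm (\<bar>H (X j) t\<bar> powr p) \<le> B powr p" for j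
      using O_sub by (intro AE_I2) auto
  qed (use Hp_int[OF x] Hp_int[OF X] in auto)
  have "(\<lambda>j. Z (X j)) \<longlonglongrightarrow> Z x"
    unfolding Z_def using p by (intro tendsto_powr2[OF P tendsto_const]) auto
  then show ?thesis
    unfolding G_def using Z_pos[OF x] by (intro tendsto_intros H t) auto
qed

section \<open>The fixed point solves the equation\<close>

lemma exists_solution:
  obtains lam x where "lam > 0" "x \<in> D" "\<And>t. t \<in> S \<Longrightarrow> lam * x t = T x t" "N x powr (1/p) = m"
proof -
  obtain x where x: "x \<in> D" and fix_x: "\<And>t. t \<in> S \<Longrightarrow> G x t = x t"
    by (rule equicontinuous_operator_fixpoint[OF compact_S r, folded D_def, of G])
       (use G_range G_equicontinuous G_pointwise_limit in blast)+
  define P where "P = (\<integral>t. \<bar>H x t\<bar> powr p \<partial>lebesgue_on \<Omega>0)"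
  have Z: "Z x > 0" by (rule Z_pos[OF x])
  have ZP: "Z x powr p = P"
    using p by (simp add: Z_def P_def powr_powr)
  have Ppos: "P > 0" using Z ZP by (metis powr_gt_zero less_irrefl)
  \<comment> \<open>The normalisation in \<open>G\<close> forces the fixed point to have norm
    \<open>m\<close>. Hence \<open>e x = 0\<close>, so \<open>H x\<close> is \<open>T x\<close>, and
    \<open>lam\<close> is \<open>Z x / m\<close>.\<close>
  have "N x = (\<integral>t. m powr p / P * \<bar>H x t\<bar> powr p \<partial>lebesgue_on \<Omega>0)"
    unfolding N_def
  proof (rule Bochner_Integration.integral_cong[OF refl])
    fix t assume "t \<in> space (lebesgue_on \<Omega>0)"
    then have "x t = m * H x t / Z x" using fix_x[of t] O_sub by (auto simp: G_def)
    then show "\<bar>x t\<bar> powr p = m powr p / P * \<bar>H x t\<bar> powr p"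
      using Z m by (simp add: abs_mult abs_divide powr_mult powr_divide ZP)
  qed
  also have "\<dots> = m powr p" using Ppos by (simp add: P_def)
  finally have Nx: "N x = m powr p" .
  have "Z x / m * x t = T x t" if "t \<in> S" for t
    using fix_x[OF that] Z m by (simp add: G_def H_def e_def Nx field_simps)
  moreover have "N x powr (1/p) = m" using m p by (simp add: Nx powr_powr)
  ultimately show ?thesis using that[of "Z x / m" x] Z m x by auto
qed

end

section \<open>From the stated hypotheses to the locale\<close>

theorem theorem3p3:
  fixes \<Omega> \<Omega>0 :: "'a::euclidean_space set"
    and r \<theta> \<eta>1 \<eta>2 m c p :: real
    and f :: "'a \<Rightarrow> real \<Rightarrow> real"
    and k :: "'a \<Rightarrow> 'a \<Rightarrow> real"
    and g \<Phi> :: "'a \<Rightarrow> real"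
  assumes "open \<Omega>" and "bounded \<Omega>" and "r > 0"
    and "\<Omega>0 \<subseteq> closure \<Omega>" and "\<Omega>0 \<in> sets lebesgue" and "measure lebesgue \<Omega>0 > 0"
    and "0 < \<theta>" and "\<theta> < 1" and "\<eta>1 > 0" and "\<eta>2 > 0" and "m > 0" and "c > 0" and "p \<ge> 1"
    \<comment> \<open>f maps into [0,+infinity)\<close>
    and f_nonneg: "\<forall>t\<in>closure \<Omega>. \<forall>u\<in>{-r..r}. f t u \<ge> 0"
    \<comment> \<open>(1) Caratheodory conditions\<close>
    and f_meas: "\<forall>u\<in>{-r..r}. set_borel_measurable lebesgue (closure \<Omega>) (\<lambda>t. f t u)"
    and f_cont: "AE t in lebesgue. t \<in> closure \<Omega> \<longrightarrow> continuous_on {-r..r} (f t)"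
    and g_meas: "set_borel_measurable lebesgue (closure \<Omega>) g"
    and g_nonneg: "\<forall>t\<in>closure \<Omega>. g t \<ge> 0"
    and f_le_g: "AE t in lebesgue. t \<in> closure \<Omega> \<longrightarrow> (\<forall>u\<in>{-r..r}. f t u \<le> g t)"
    \<comment> \<open>(2)\<close>
    and f_lower: "AE t in lebesgue. t \<in> \<Omega>0 \<longrightarrow>
        (\<forall>u. \<theta> * m * measure lebesgue \<Omega>0 powr (-1/p) \<le> \<bar>u\<bar> \<and> \<bar>u\<bar> \<le> r \<longrightarrow> \<eta>1 \<le> f t u)"
    \<comment> \<open>(3)\<close>
    and k_meas: "set_borel_measurable (lebesgue :: ('a \<times> 'a) measure) (closure \<Omega> \<times> closure \<Omega>) (\<lambda>(t, s). k t s)"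
    and k_meas2: "\<forall>\<tau>\<in>closure \<Omega>. set_borel_measurable lebesgue (closure \<Omega>) (\<lambda>s. k \<tau> s)"
    and k_cont: "\<forall>\<tau>\<in>closure \<Omega>.
        ((\<lambda>t. \<integral>\<^sup>+ s\<in>closure \<Omega>. ennreal (\<bar>k t s - k \<tau> s\<bar> * g s) \<partial>lebesgue) \<longlongrightarrow> 0)
          (at \<tau> within closure \<Omega>)"
    \<comment> \<open>(4)\<close>
    and \<Phi>_meas: "set_borel_measurable lebesgue (closure \<Omega>) \<Phi>"
    and \<Phi>_nonneg: "\<forall>t\<in>closure \<Omega>. \<Phi> t \<ge> 0"
    and \<Phi>_lower: "AE t in lebesgue. t \<in> \<Omega>0 \<longrightarrow> \<Phi> t \<ge> \<eta>2"
    and k_bound: "\<forall>t\<in>closure \<Omega>. AE s in lebesgue. s \<in> closure \<Omega> \<longrightarrow> \<bar>k t s\<bar> \<le> \<Phi> s"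
    and k_lower: "AE s in lebesgue. s \<in> closure \<Omega> \<longrightarrow> c * \<Phi> s \<le> (\<integral>t\<in>\<Omega>0. k t s \<partial>lebesgue)"
    \<comment> \<open>(5)\<close>
    and \<Phi>g_fin: "(\<integral>\<^sup>+ s\<in>closure \<Omega>. ennreal (\<Phi> s * g s) \<partial>lebesgue) < \<infinity>"
    \<comment> \<open>(6): 1/q = 1 - 1/p, with q = infinity when p = 1\<close>
    and m_le: "m \<le> r * c * measure lebesgue \<Omega>0 powr (-(1 - 1/p))"
  shows "\<exists>lam>0. \<exists>x :: 'a \<Rightarrow> real.
           continuous_on (closure \<Omega>) x
         \<and> (\<forall>t\<in>closure \<Omega>. x t \<in> {-r..r})
         \<and> (\<forall>t\<in>closure \<Omega>. set_integrable lebesgue (closure \<Omega>) (\<lambda>s. k t s * f s (x s))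
               \<and> lam * x t = (\<integral>s\<in>closure \<Omega>. k t s * f s (x s) \<partial>lebesgue))
         \<and> (\<integral>t\<in>\<Omega>0. \<bar>x t\<bar> powr p \<partial>lebesgue) powr (1/p) = m"
proof -
  define S where "S = closure \<Omega>"
  have compact: "compact S" using \<open>bounded \<Omega>\<close> by (simp add: S_def compact_closure)
  then have S: "S \<in> sets lebesgue" by (simp add: lmeasurable_compact fmeasurableD)
  have O: "\<Omega>0 \<in> sets lebesgue" by fact
  have meas: "set_borel_measurable lebesgue A h \<longleftrightarrow> h \<in> borel_measurable (lebesgue_on A)"
    if "A \<in> sets lebesgue" for A :: "'a set" and h :: "'a \<Rightarrow> real"
    using that by (simp add: set_borel_measurable_def borel_measurable_restrict_space_iff)
  have ae: "(AE t in lebesgue_on A. P t) \<longleftrightarrow> (AE t in lebesgue. t \<in> A \<longrightarrow> P t)"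
    if "A \<in> sets lebesgue" for A :: "'a set" and P
    using that by (simp add: AE_restrict_space_iff)
  have lint: "(\<integral>t\<in>A. h t \<partial>lebesgue) = (\<integral>t. h t \<partial>lebesgue_on A)"
    if "A \<in> sets lebesgue" for A :: "'a set" and h :: "'a \<Rightarrow> real"
    using that by (simp add: set_lebesgue_integral_def integral_restrict_space)
  have nint: "(\<integral>\<^sup>+ t\<in>A. h t \<partial>lebesgue) = (\<integral>\<^sup>+ t. h t \<partial>lebesgue_on A)"
    if "A \<in> sets lebesgue" for A :: "'a set" and h :: "'a \<Rightarrow> ennreal"
    using that by (simp add: nn_integral_restrict_space)
  note g_m = g_meas[folded S_def, unfolded meas[OF S]]
  note \<Phi>_m = \<Phi>_meas[folded S_def, unfolded meas[OF S]]
  have k_m: "k t \<in> borel_measurable (lebesgue_on S)" if "t \<in> S" for t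
    using k_meas2[folded S_def] that meas[OF S] by blast
  have k_b: "AE s in lebesgue_on S. \<bar>k t s\<bar> \<le> \<Phi> s" if "t \<in> S" for t
    using k_bound[folded S_def] that ae[OF S] by blast
  have \<Phi>g: "integrable (lebesgue_on S) (\<lambda>s. \<Phi> s * g s)"
  proof (rule integrableI_nonneg)
    show "AE s in lebesgue_on S. 0 \<le> \<Phi> s * g s"
      by (rule AE_I2) (use g_nonneg \<Phi>_nonneg in \<open>auto simp: S_def\<close>)
    show "(\<integral>\<^sup>+ s. ennreal (\<Phi> s * g s) \<partial>lebesgue_on S) < \<infinity>"
      using \<Phi>g_fin[folded S_def] by (simp only: nint[OF S])
  qed (use g_m \<Phi>_m in measurable)
  \<comment> \<open>With this integrability the extended nonnegative integrals in
    \<open>k_cont\<close> are finite, so their limit is also a limit of Bochner integrals.\<close>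
  have diff_int: "integrable (lebesgue_on S) (\<lambda>s. \<bar>k t s - k \<tau> s\<bar> * g s)" if "t \<in> S" "\<tau> \<in> S" for t \<tau>
  proof (rule Bochner_Integration.integrable_bound[of _ "\<lambda>s. 2 * (\<Phi> s * g s)"])
    show "(\<lambda>s. \<bar>k t s - k \<tau> s\<bar> * g s) \<in> borel_measurable (lebesgue_on S)"
      using k_m[OF that(1)] k_m[OF that(2)] g_m by measurable
    show "AE s in lebesgue_on S. norm (\<bar>k t s - k \<tau> s\<bar> * g s) \<le> norm (2 * (\<Phi> s * g s))"
      using k_b[OF that(1)] k_b[OF that(2)] AE_space
    proof eventually_elim
      fix s assume b: "\<bar>k t s\<bar> \<le> \<Phi> s" "\<bar>k \<tau> s\<bar> \<le> \<Phi> s" and "s \<in> space (lebesgue_on S)"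
      then have "0 \<le> g s" "0 \<le> \<Phi> s" using g_nonneg \<Phi>_nonneg by (auto simp: S_def)
      moreover have "\<bar>k t s - k \<tau> s\<bar> \<le> 2 * \<Phi> s" using b by linarith
      ultimately show "norm (\<bar>k t s - k \<tau> s\<bar> * g s) \<le> norm (2 * (\<Phi> s * g s))"
        using mult_right_mono[of "\<bar>k t s - k \<tau> s\<bar>" "2 * \<Phi> s" "g s"] by (simp add: abs_mult)
    qed
  qed (use \<Phi>g in simp)
  interpret hammerstein S \<Omega>0 r \<theta> \<eta>1 \<eta>2 m c p f k g \<Phi>
  proof
    show "AE t in lebesgue_on S. continuous_on {-r..r} (f t)"
      using f_cont by (simp only: ae[OF S] S_def[symmetric])
    show "AE t in lebesgue_on S. \<forall>u\<in>{-r..r}. f t u \<le> g t"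
      using f_le_g by (simp only: ae[OF S] S_def[symmetric])
    show "AE t in lebesgue_on \<Omega>0. \<forall>u. \<theta> * m * measure lebesgue \<Omega>0 powr (-1/p) \<le> \<bar>u\<bar> \<and> \<bar>u\<bar> \<le> r \<longrightarrow> \<eta>1 \<le> f t u"
      using f_lower by (simp only: ae[OF O])
    show "AE t in lebesgue_on \<Omega>0. \<eta>2 \<le> \<Phi> t"
      using \<Phi>_lower by (simp only: ae[OF O])
    show "AE s in lebesgue_on S. c * \<Phi> s \<le> (\<integral>t. k t s \<partial>lebesgue_on \<Omega>0)"
      using k_lower by (simp only: ae[OF S] S_def[symmetric] lint[OF O])
    show "(\<lambda>t. f t u) \<in> borel_measurable (lebesgue_on S)" if "u \<in> {-r..r}" for u
      using f_meas[folded S_def] that meas[OF S] by blast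
    show "((\<lambda>t. \<integral>s. \<bar>k t s - k \<tau> s\<bar> * g s \<partial>lebesgue_on S) \<longlongrightarrow> 0) (at \<tau> within S)" if \<tau>: "\<tau> \<in> S" for \<tau>
    proof -
      have eq: "(\<integral>\<^sup>+ s\<in>S. ennreal (\<bar>k t s - k \<tau> s\<bar> * g s) \<partial>lebesgue) = ennreal (\<integral>s. \<bar>k t s - k \<tau> s\<bar> * g s \<partial>lebesgue_on S)"
        if "t \<in> S" for t
        unfolding nint[OF S]
        by (rule nn_integral_eq_integral[OF diff_int[OF that \<tau>]], rule AE_I2) (use g_nonneg in \<open>auto simp: S_def\<close>)
      have "((\<lambda>t. \<integral>\<^sup>+ s\<in>S. ennreal (\<bar>k t s - k \<tau> s\<bar> * g s) \<partial>lebesgue) \<longlongrightarrow> 0) (at \<tau> within S)"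
        using k_cont[folded S_def] \<tau> by blast
      then have "((\<lambda>t. ennreal (\<integral>s. \<bar>k t s - k \<tau> s\<bar> * g s \<partial>lebesgue_on S)) \<longlongrightarrow> ennreal 0) (at \<tau> within S)"
        by (rule Lim_transform_eventually[THEN tendsto_eq_rhs]) (auto simp: eventually_at_filter eq)
      then show ?thesis
        by (subst (asm) tendsto_ennreal_iff)
           (auto intro!: always_eventually integral_nonneg_AE AE_I2 mult_nonneg_nonneg simp: g_nonneg S_def)
    qed
    show "set_borel_measurable lebesgue (S \<times> S) (\<lambda>(t, s). k t s)"
      using k_meas by (simp only: S_def)
  qed (use assms compact g_m \<Phi>_m k_m k_b \<Phi>g in \<open>auto simp: S_def\<close>)
  obtain lam x where sol: "lam > 0" "x \<in> D" "\<And>t. t \<in> S \<Longrightarrow> lam * x t = T x t" "N x powr (1/p) = m"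
    using exists_solution by blast
  have "set_integrable lebesgue S (\<lambda>s. k t s * f s (x s))" if "t \<in> S" for t
    using kf_int[OF sol(2) that] S by (simp add: set_integrable_def integrable_restrict_space)
  then show ?thesis
    using sol D_range[OF sol(2)]
    by (intro exI[of _ lam] conjI exI[of _ x])
       (auto simp: S_def[symmetric] D_def T_def N_def lint[OF S] lint[OF O])
qed

end
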